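(* Let $B$ be a skew brace such that $B/\operatorname{Z}(B)$ is finite of order $t$. Then $[B,B]^B$ is finite and \[|[B,B]^B|\leq \frac{\omega\bigl(t^2/|\ker\lambda:\ker\lambda\cap (\operatorname{Z}(B),\cdot)|\bigr)}{|((B,\cdot)/\ker\lambda)'|},\] where $((B,\cdot)/\ker\lambda)'$ denotes the derived (commutator) subgroup of the group $(B,\cdot)/\ker\lambda$.
   Context: For an integer $s>1$ with smallest prime divisor $p$, $\omega(s)=s^{m}$ with $m=(\log_p(s)-1)/2$; also $\omega(1)=1$. A skew (left) brace $(B,+,\cdot)$ is a set $B$ with two group structures $(B,+)$ and $(B,\cdot)$ (neither assumed abelian or finite) such that $a(b+c)=ab-a+ac$ for all $a,b,c\in B$; the two groups share the identity element $0$. Put $a*b=-a+ab-b$ and $\lambda_a(b)=-a+ab$; $a\mapsto\lambda_a$ is a homomorphism $\lambda:(B,\cdot)\to\operatorname{Aut}(B,+)$. For $X,Y\subseteq B$, $X*Y$ is the subgroup of $(B,+)$ generated by $\{x*y\mid x\in X,y\in Y\}$, and $[X,Y]_+$, $[X,Y]_\bullet$ are the commutator subgroups of $X$ and $Y$ in $(B,+)$ and $(B,\cdot)$, respectively. A subbrace is a subset that is a subgroup of both $(B,+)$ and $(B,\cdot)$. An ideal is a subbrace $I$ with $(I,+)$ normal in $(B,+)$, $B*I\subseteq I$ and $I*B\subseteq I$; then the quotient skew brace $B/I$ is defined. $\langle X\rangle^B$ is the smallest ideal of $B$ containing $X$. For ideals $I,J$, $[I,J]^B=\langle [I,J]_+\cup[I,J]_\bullet\cup\{ij-(i+j)\mid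 i\in I,j\in J\}\rangle^B$; the derived ideal of $B$ is $[B,B]^B$. $\ker\lambda=\{a\in B\mid \lambda_a(b)=b\ \forall b\in B\}$, regarded as a (normal) subgroup of $(B,\cdot)$, and the centre is the ideal $\operatorname{Z}(B)=\ker\lambda\cap \operatorname{Z}(B,+)\cap \operatorname{Z}(B,\cdot)$, where $\operatorname{Z}(B,+)$ and $\operatorname{Z}(B,\cdot)$ are the centres of the two groups. $(\operatorname{Z}(B),\cdot)$ is the multiplicative group of $\operatorname{Z}(B)$. *)

theory Defs
  imports
    Complex_Main
    "HOL-Computational_Algebra.Primes"
    "HOL-Algebra.Generated_Groups"
    "HOL-Algebra.QuotRing"
begin

text \<open>
  Skew braces are carried by the \<^type>\<open>ring\<close> record of HOL-Algebra: \<open>add_monoid B\<close> is the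
  group \<open>(B, +)\<close>, not assumed commutative, and \<open>B\<close> itself, read as a monoid record, is the
  group \<open>(B, \<cdot>)\<close>.  No ring axioms are assumed.
\<close>

locale skew_brace =
  fixes B (structure)
  assumes add_group: "group (add_monoid B)"
    and mult_group: "group B"
    and brace_distrib: "\<lbrakk>a \<in> carrier B; b \<in> carrier B; c \<in> carrier B\<rbrakk>
      \<Longrightarrow> a \<otimes> (b \<oplus> c) = ((a \<otimes> b) \<ominus> a) \<oplus> (a \<otimes> c)"

definition brace_lambda :: "('a, 'm) ring_scheme \<Rightarrow> 'a \<Rightarrow> 'a \<Rightarrow> 'a" where
  "brace_lambda B a b = (\<ominus>\<^bsub>B\<^esub> a) \<oplus>\<^bsub>B\<^esub> (a \<otimes>\<^bsub>B\<^esub> b)"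

definition brace_star :: "('a, 'm) ring_scheme \<Rightarrow> 'a \<Rightarrow> 'a \<Rightarrow> 'a" where
  "brace_star B a b = ((\<ominus>\<^bsub>B\<^esub> a) \<oplus>\<^bsub>B\<^esub> (a \<otimes>\<^bsub>B\<^esub> b)) \<ominus>\<^bsub>B\<^esub> b"

definition brace_star_set :: "('a, 'm) ring_scheme \<Rightarrow> 'a set \<Rightarrow> 'a set \<Rightarrow> 'a set" where
  "brace_star_set B X Y = generate (add_monoid B) {brace_star B x y | x y. x \<in> X \<and> y \<in> Y}"

definition commutator_subgroup :: "('a, 'm) monoid_scheme \<Rightarrow> 'a set \<Rightarrow> 'a set \<Rightarrow> 'a set" where
  "commutator_subgroup G X Y =
     generate G {x \<otimes>\<^bsub>G\<^esub> y \<otimes>\<^bsub>G\<^esub> inv\<^bsub>G\<^esub> x \<otimes>\<^bsub>G\<^esub> inv\<^bsub>G\<^esub> y | x y. x \<in> X \<and> y \<in> Y}"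

definition group_centre :: "('a, 'm) monoid_scheme \<Rightarrow> 'a set" where
  "group_centre G = {x \<in> carrier G. \<forall>y \<in> carrier G. x \<otimes>\<^bsub>G\<^esub> y = y \<otimes>\<^bsub>G\<^esub> x}"

definition subbrace :: "'a set \<Rightarrow> ('a, 'm) ring_scheme \<Rightarrow> bool" where
  "subbrace S B \<longleftrightarrow> subgroup S (add_monoid B) \<and> subgroup S B"

definition brace_ideal :: "'a set \<Rightarrow> ('a, 'm) ring_scheme \<Rightarrow> bool" where
  "brace_ideal I B \<longleftrightarrow> subbrace I B \<and> I \<lhd> add_monoid B \<and>
     brace_star_set B (carrier B) I \<subseteq> I \<and> brace_star_set B I (carrier B) \<subseteq> I"

definition brace_genideal :: "('a, 'm) ring_scheme \<Rightarrow> 'a set \<Rightarrow> 'a set" where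
  "brace_genideal B X = \<Inter>{I. brace_ideal I B \<and> X \<subseteq> I}"

definition brace_commutator :: "('a, 'm) ring_scheme \<Rightarrow> 'a set \<Rightarrow> 'a set \<Rightarrow> 'a set" where
  "brace_commutator B I J = brace_genideal B
     (commutator_subgroup (add_monoid B) I J \<union> commutator_subgroup B I J \<union>
      {(i \<otimes>\<^bsub>B\<^esub> j) \<ominus>\<^bsub>B\<^esub> (i \<oplus>\<^bsub>B\<^esub> j) | i j. i \<in> I \<and> j \<in> J})"

definition ker_lambda :: "('a, 'm) ring_scheme \<Rightarrow> 'a set" where
  "ker_lambda B = {a \<in> carrier B. \<forall>b \<in> carrier B. brace_lambda B a b = b}"

definition brace_centre :: "('a, 'm) ring_scheme \<Rightarrow> 'a set" where
  "brace_centre B = ker_lambda B \<inter> group_centre (add_monoid B) \<inter> group_centre B"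

text \<open>Only values at \<open>s \<ge> 1\<close> are meaningful.\<close>

definition omega :: "nat \<Rightarrow> real" where
  "omega s = (if s = 1 then 1
     else let p = (LEAST p. prime p \<and> p dvd s)
          in real s powr ((log (real p) (real s) - 1) / 2))"

context skew_brace
begin

sublocale plus: group "add_monoid B"
  rewrites "carrier (add_monoid B) = carrier B"
    and "monoid.mult (add_monoid B) = (\<oplus>)"
    and "one (add_monoid B) = \<zero>"
    and "m_inv (add_monoid B) = a_inv B"
  by (auto simp: add_group a_inv_def)

sublocale times: group B
  by (rule mult_group)

lemma zero_eq_one: "\<zero> = \<one>"
proof -
  have "\<zero> \<otimes> (\<zero> \<oplus> \<zero>) = ((\<zero> \<otimes> \<zero>) \<ominus> \<zero>) \<oplus> (\<zero> \<otimes> \<zero>)"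
    by (rule brace_distrib) auto
  then have "\<zero> \<otimes> \<zero> = \<zero>"
    by (simp add: a_minus_def)
  then show ?thesis
    by (metis plus.one_closed times.l_cancel_one')
qed

lemma minus_closed: "\<lbrakk>a \<in> carrier B; b \<in> carrier B\<rbrakk> \<Longrightarrow> a \<ominus> b \<in> carrier B"
  by (simp add: a_minus_def)

lemma lambda_closed: "\<lbrakk>a \<in> carrier B; b \<in> carrier B\<rbrakk> \<Longrightarrow> brace_lambda B a b \<in> carrier B"
  by (simp add: brace_lambda_def)

lemma mult_eq: "\<lbrakk>a \<in> carrier B; b \<in> carrier B\<rbrakk> \<Longrightarrow> a \<otimes> b = a \<oplus> brace_lambda B a b"
  by (simp add: brace_lambda_def flip: plus.m_assoc)

lemma lambda_add:
  "\<lbrakk>a \<in> carrier B; b \<in> carrier B; c \<in> carrier B\<rbrakk>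
    \<Longrightarrow> brace_lambda B a (b \<oplus> c) = brace_lambda B a b \<oplus> brace_lambda B a c"
  by (simp add: brace_lambda_def brace_distrib a_minus_def plus.m_assoc)

lemma lambda_mult:
  assumes "a \<in> carrier B" "b \<in> carrier B" "c \<in> carrier B"
  shows "brace_lambda B (a \<otimes> b) c = brace_lambda B a (brace_lambda B b c)"
proof -
  have "a \<oplus> (brace_lambda B a b \<oplus> brace_lambda B a (brace_lambda B b c)) = a \<otimes> (b \<otimes> c)"
    using assms by (simp add: mult_eq lambda_closed lambda_add)
  also have "\<dots> = (a \<otimes> b) \<otimes> c"
    using assms by (simp add: times.m_assoc)
  also have "\<dots> = (a \<otimes> b) \<oplus> brace_lambda B (a \<otimes> b) c"
    using assms by (simp add: mult_eq[of "a \<otimes> b" c])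
  also have "\<dots> = a \<oplus> (brace_lambda B a b \<oplus> brace_lambda B (a \<otimes> b) c)"
    using assms by (simp add: mult_eq[of a b] plus.m_assoc lambda_closed)
  finally show ?thesis
    using assms by (simp add: lambda_closed)
qed

lemma lambda_one: "c \<in> carrier B \<Longrightarrow> brace_lambda B \<one> c = c"
  using mult_eq[of \<one> c] lambda_closed[of \<one> c]
  by (metis plus.l_one times.l_one times.one_closed zero_eq_one)

lemma lambda_inv:
  "\<lbrakk>a \<in> carrier B; c \<in> carrier B\<rbrakk> \<Longrightarrow> brace_lambda B (inv a) (brace_lambda B a c) = c"
  by (metis lambda_mult lambda_one times.inv_closed times.l_inv)

lemma lambda_inv':
  "\<lbrakk>a \<in> carrier B; c \<in> carrier B\<rbrakk> \<Longrightarrow> brace_lambda B a (brace_lambda B (inv a) c) = c"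
  by (metis lambda_mult lambda_one times.inv_closed times.r_inv)

lemma star_lambda: "brace_star B a b = brace_lambda B a b \<ominus> b"
  by (simp add: brace_star_def brace_lambda_def)

lemma kerD:
  assumes "a \<in> ker_lambda B"
  shows "a \<in> carrier B" "b \<in> carrier B \<Longrightarrow> brace_lambda B a b = b"
    "b \<in> carrier B \<Longrightarrow> a \<otimes> b = a \<oplus> b"
  using assms by (auto simp: ker_lambda_def mult_eq)

lemma ker_lambda_normal: "ker_lambda B \<lhd> B"
proof (rule times.normal_invI)
  show "subgroup (ker_lambda B) B"
  proof (rule times.subgroupI)
    show "ker_lambda B \<subseteq> carrier B" by (auto simp: ker_lambda_def)
    show "ker_lambda B \<noteq> {}" using lambda_one by (auto simp: ker_lambda_def)
  next
    fix a assume "a \<in> ker_lambda B"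
    then show "inv a \<in> ker_lambda B"
      unfolding ker_lambda_def using lambda_inv by fastforce
  next
    fix a b assume "a \<in> ker_lambda B" "b \<in> ker_lambda B"
    then show "a \<otimes> b \<in> ker_lambda B"
      by (auto simp: ker_lambda_def lambda_mult)
  qed
  show "x \<otimes> h \<otimes> inv x \<in> ker_lambda B" if "x \<in> carrier B" "h \<in> ker_lambda B" for x h
    using that by (auto simp: ker_lambda_def lambda_mult lambda_inv' lambda_closed)
qed

lemma centreD:
  assumes "z \<in> brace_centre B"
  shows "z \<in> ker_lambda B" "z \<in> carrier B" "b \<in> carrier B \<Longrightarrow> z \<oplus> b = b \<oplus> z"
    "b \<in> carrier B \<Longrightarrow> z \<otimes> b = b \<otimes> z" "b \<in> carrier B \<Longrightarrow> z \<otimes> b = z \<oplus> b"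
    "b \<in> carrier B \<Longrightarrow> brace_lambda B b z = z"
proof -
  show 1: "z \<in> ker_lambda B" "z \<in> carrier B" "b \<in> carrier B \<Longrightarrow> z \<oplus> b = b \<oplus> z"
    "b \<in> carrier B \<Longrightarrow> z \<otimes> b = b \<otimes> z"
    using assms by (auto simp: brace_centre_def group_centre_def ker_lambda_def)
  show 2: "b \<in> carrier B \<Longrightarrow> z \<otimes> b = z \<oplus> b"
    using 1 kerD by blast
  show "b \<in> carrier B \<Longrightarrow> brace_lambda B b z = z"
    using 1 2 mult_eq[of b z] by (metis lambda_closed plus.Units_l_cancel plus.Units_eq)
qed

lemma centre_memI:
  assumes "z \<in> carrier B" "\<And>b. b \<in> carrier B \<Longrightarrow> z \<oplus> b = b \<oplus> z"
    "\<And>b. b \<in> carrier B \<Longrightarrow> z \<otimes> b = b \<otimes> z" "\<And>b. b \<in> carrier B \<Longrightarrow> z \<otimes> b = z \<oplus> b"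
  shows "z \<in> brace_centre B"
proof -
  have "brace_lambda B z b = b" if "b \<in> carrier B" for b
    using that assms(1) assms(4)[OF that] by (simp add: brace_lambda_def flip: plus.m_assoc)
  then show ?thesis
    using assms(1-3) by (auto simp: brace_centre_def group_centre_def ker_lambda_def)
qed

lemma centre_subgroup: "subgroup (brace_centre B) B"
proof (rule times.subgroupI)
  show "brace_centre B \<subseteq> carrier B" using centreD by blast
  have "\<one> \<in> brace_centre B"
    by (rule centre_memI) (simp_all flip: zero_eq_one, simp_all add: zero_eq_one)
  then show "brace_centre B \<noteq> {}" by blast
next
  fix a b assume a: "a \<in> brace_centre B" and b: "b \<in> brace_centre B"
  note [simp] = centreD(2)[OF a] centreD(2)[OF b]
  show "a \<otimes> b \<in> brace_centre B"
  proof (rule centre_memI)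
    fix c assume c [simp]: "c \<in> carrier B"
    show "a \<otimes> b \<oplus> c = c \<oplus> a \<otimes> b"
      using centreD(3,5)[OF a] centreD(3)[OF b]
      by (metis c \<open>a \<in> carrier B\<close> \<open>b \<in> carrier B\<close> plus.m_assoc)
    show "a \<otimes> b \<otimes> c = c \<otimes> (a \<otimes> b)"
      using centreD(4)[OF a] centreD(4)[OF b]
      by (metis c \<open>a \<in> carrier B\<close> \<open>b \<in> carrier B\<close> times.m_assoc)
    show "a \<otimes> b \<otimes> c = a \<otimes> b \<oplus> c"
      using times.m_assoc[of a b c] plus.m_assoc[of a b c]
      by (simp add: centreD(5)[OF a] centreD(5)[OF b])
  qed simp
next
  fix a assume a: "a \<in> brace_centre B"
  note [simp] = centreD(2)[OF a]
  have "a \<oplus> inv a = \<zero>"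
    using centreD(5)[OF a, of "inv a"] by (simp add: zero_eq_one)
  then have i: "inv a = \<ominus> a"
    by (metis \<open>a \<in> carrier B\<close> plus.inv_comm plus.inv_equality times.inv_closed)
  show "inv a \<in> brace_centre B"
  proof (rule centre_memI)
    fix c assume c [simp]: "c \<in> carrier B"
    show "inv a \<oplus> c = c \<oplus> inv a"
      unfolding i by (metis \<open>a \<in> carrier B\<close> c centreD(3)[OF a] plus.inv_closed plus.inv_solve_left
          plus.inv_solve_right plus.m_assoc plus.m_closed)
    show "inv a \<otimes> c = c \<otimes> inv a"
      by (metis \<open>a \<in> carrier B\<close> c centreD(4)[OF a] times.inv_closed times.inv_solve_left
          times.inv_solve_right times.m_assoc times.m_closed)
    have "inv a \<in> ker_lambda B"
      using normal_imp_subgroup[OF ker_lambda_normal] centreD(1)[OF a]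
      by (rule subgroup.m_inv_closed)
    then show "inv a \<otimes> c = inv a \<oplus> c"
      by (simp add: kerD(3))
  qed simp
qed

lemma subgroup_plus_of_ker:
  assumes "subgroup S B" "S \<subseteq> ker_lambda B"
  shows "subgroup S (add_monoid B)"
proof -
  have sub: "S \<subseteq> carrier B"
    using assms(1) by (rule subgroup.subset)
  have one: "\<one> \<in> S"
    using assms(1) by (rule subgroup.one_closed)
  have add: "a \<oplus> b \<in> S" if "a \<in> S" "b \<in> S" for a b
    using subgroup.m_closed[OF assms(1) that] kerD(3)[of a b] that assms(2) sub
    by (metis subsetD)
  have uminus: "\<ominus> a \<in> S" if "a \<in> S" for a
  proof -
    have a: "a \<in> carrier B" "a \<in> ker_lambda B" and ia: "inv a \<in> S"
      using that sub assms(2) subgroup.m_inv_closed[OF assms(1)] by auto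
    have "a \<oplus> inv a = \<zero>"
      using a kerD(3)[of a "inv a"] by (simp add: zero_eq_one)
    then have "inv a = \<ominus> a"
      using a by (metis plus.inv_comm plus.inv_equality times.inv_closed)
    then show ?thesis using ia by simp
  qed
  show ?thesis
    using sub one add uminus by (intro group.subgroupI[OF add_group]) (auto simp flip: a_inv_def)
qed

lemma star_set_subset:
  assumes "subgroup I (add_monoid B)" "\<And>x y. \<lbrakk>x \<in> X; y \<in> Y\<rbrakk> \<Longrightarrow> brace_star B x y \<in> I"
  shows "brace_star_set B X Y \<subseteq> I"
  unfolding brace_star_set_def
  by (rule group.generate_subgroup_incl[OF add_group _ assms(1)]) (use assms(2) in blast)

lemma centre_ideal: "brace_ideal (brace_centre B) B"
proof -
  have Z: "brace_centre B \<subseteq> ker_lambda B" using centreD(1) by blast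
  note sg = subgroup_plus_of_ker[OF centre_subgroup Z]
  have z: "\<zero> \<in> brace_centre B"
    using subgroup.one_closed[OF sg] by simp
  have "brace_centre B \<lhd> add_monoid B"
  proof (rule group.normal_invI[OF add_group sg])
    fix x h assume "x \<in> carrier (add_monoid B)" and h: "h \<in> brace_centre B"
    then have x: "x \<in> carrier B" by simp
    have "x \<oplus> h \<oplus> \<ominus> x = h"
      using x centreD(2)[OF h] centreD(3)[OF h x] by (metis plus.inv_solve_right' plus.m_closed)
    then show "x \<otimes>\<^bsub>add_monoid B\<^esub> h \<otimes>\<^bsub>add_monoid B\<^esub> inv\<^bsub>add_monoid B\<^esub> x \<in> brace_centre B"
      using h by (simp flip: a_inv_def)
  qed
  moreover have "brace_star_set B (carrier B) (brace_centre B) \<subseteq> brace_centre B"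
    by (rule star_set_subset[OF sg])
      (simp add: star_lambda centreD a_minus_def z)
  moreover have "brace_star_set B (brace_centre B) (carrier B) \<subseteq> brace_centre B"
    by (rule star_set_subset[OF sg])
      (simp add: star_lambda centreD(1) kerD(2) a_minus_def z)
  ultimately show ?thesis
    using sg centre_subgroup by (simp add: brace_ideal_def subbrace_def)
qed

text \<open>The additive and the multiplicative cosets of the centre agree.  Hence the index of the
  centre in the kernel of \<open>\<lambda>\<close> divides the order \<open>t\<close> of the quotient by the centre, so that dividing
  \<open>t\<^sup>2\<close> by this index with \<open>div\<close> on natural numbers is exact.\<close>

lemma centre_cosets: "rcosets (brace_centre B) = carrier (B Quot brace_centre B)"
proof -
  have "brace_centre B #> x = brace_centre B +> x" if "x \<in> carrier B" for x
    using that by (auto simp: r_coset_def a_r_coset_def' centreD(5))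
  then show ?thesis
    by (auto simp: FactRing_def RCOSETS_def A_RCOSETS_def')
qed

lemma ker_index_dvd:
  "card (rcosets\<^bsub>B\<lparr>carrier := ker_lambda B\<rparr>\<^esub> (ker_lambda B \<inter> brace_centre B))
     dvd order (B Quot brace_centre B)"
proof -
  have Z: "brace_centre B \<subseteq> ker_lambda B" using centreD(1) by blast
  have nZ: "brace_centre B \<lhd> B"
  proof (rule times.normal_invI[OF centre_subgroup])
    fix x h assume "x \<in> carrier B" "h \<in> brace_centre B"
    then show "x \<otimes> h \<otimes> inv x \<in> brace_centre B"
      by (metis centreD(2,4) times.inv_solve_right' times.m_closed)
  qed
  have "subgroup (rcosets\<^bsub>B\<lparr>carrier := ker_lambda B\<rparr>\<^esub> brace_centre B) (B Mod brace_centre B)"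
    using times.normal_subgroup_factorize[OF nZ Z normal_imp_subgroup[OF ker_lambda_normal]] .
  from group.lagrange[OF normal.factorgroup_is_group[OF nZ] this]
  show ?thesis
    using Z by (simp add: order_def FactGroup_def centre_cosets Int_absorb1) (metis dvd_triv_right)
qed

text \<open>Although \<^const>\<open>FactRing\<close> comes from ring theory, it is the quotient skew brace.\<close>

lemma ideal_lambda:
  assumes "brace_ideal I B" "a \<in> carrier B" "x \<in> I"
  shows "brace_lambda B a x \<in> I"
proof -
  have sg: "subgroup I (add_monoid B)" and "brace_star_set B (carrier B) I \<subseteq> I"
    using assms(1) by (auto simp: brace_ideal_def subbrace_def)
  then have "brace_star B a x \<in> I"
    using assms(2,3) unfolding brace_star_set_def by (blast intro: generate.incl)
  moreover have x: "x \<in> carrier B"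
    using subgroup.subset[OF sg] assms(3) by auto
  moreover have "brace_lambda B a x = brace_star B a x \<oplus> x"
    using x assms(2) by (simp add: star_lambda a_minus_def plus.m_assoc lambda_closed)
  ultimately show ?thesis
    using subgroup.m_closed[OF sg] assms(3) by simp
qed

lemma ideal_coset_mult:
  assumes I: "brace_ideal I B" and a: "a \<in> carrier B" and b: "b \<in> carrier B"
  shows "rcoset_mult B I (I +> a) (I +> b) = I +> (a \<otimes> b)"
proof -
  have sg: "subgroup I (add_monoid B)" and nm: "I \<lhd> add_monoid B"
    and st: "brace_star_set B I (carrier B) \<subseteq> I"
    using I by (auto simp: brace_ideal_def subbrace_def)
  have sub: "x \<in> carrier B" if "x \<in> I" for x
    using subgroup.subset[OF sg] that by auto
  have add: "x \<oplus> y \<in> I" if "x \<in> I" "y \<in> I" for x y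
    using subgroup.m_closed[OF sg that] by simp
  have zero: "\<zero> \<in> I" using subgroup.one_closed[OF sg] by simp
  have conj: "x \<oplus> h \<oplus> \<ominus> x \<in> I" if "x \<in> carrier B" "h \<in> I" for x h
    using normal.inv_op_closed2[OF nm, of x h] that by (simp flip: a_inv_def)
  have abs: "I +> (u \<oplus> c) = I +> c" if "u \<in> I" "c \<in> carrier B" for u c
    using group.coset_mult_assoc[OF add_group, of I u c]
      group.coset_join2[OF add_group _ sg, of u] that sub subgroup.subset[OF sg]
    by (simp add: a_r_coset_def)
  have key: "I +> ((x \<oplus> a) \<otimes> (y \<oplus> b)) = I +> (a \<otimes> b)" if x: "x \<in> I" and y: "y \<in> I" for x y
  proof -
    define x' where "x' = \<ominus> a \<oplus> x \<oplus> a"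
    have x': "x' \<in> I"
      unfolding x'_def using conj[of "\<ominus> a" x] a x by simp
    define z where "z = brace_lambda B (inv a) x'"
    have z: "z \<in> I" unfolding z_def using ideal_lambda[OF I] a x' by simp
    have "x \<oplus> a = a \<oplus> x'"
      unfolding x'_def using a sub[OF x] by (simp flip: plus.m_assoc)
    also have "\<dots> = a \<otimes> z"
      using a sub[OF z] sub[OF x'] by (simp add: mult_eq z_def lambda_inv')
    finally have xa: "x \<oplus> a = a \<otimes> z" .
    define w where "w = y \<oplus> b"
    have w: "w \<in> carrier B" using sub[OF y] b by (simp add: w_def)
    have zw: "brace_star B z w \<in> I"
      using st z w unfolding brace_star_set_def by (blast intro: generate.incl)
    define u where "u = z \<oplus> brace_star B z w \<oplus> y"
    have u: "u \<in> I" unfolding u_def using add z zw y by blast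
    have "z \<otimes> w = z \<oplus> (brace_star B z w \<oplus> w)"
      using sub[OF z] w by (simp add: mult_eq star_lambda a_minus_def plus.m_assoc lambda_closed)
    also have "\<dots> = u \<oplus> b"
      unfolding u_def using sub z zw y b by (simp add: w_def plus.m_assoc)
    finally have zw': "z \<otimes> w = u \<oplus> b" .
    define v where "v = brace_lambda B a u"
    have v: "v \<in> I" unfolding v_def using ideal_lambda[OF I a u] .
    have "(x \<oplus> a) \<otimes> w = a \<otimes> (u \<oplus> b)"
      unfolding xa using a sub[OF z] w by (simp add: times.m_assoc zw')
    also have "\<dots> = a \<oplus> (v \<oplus> brace_lambda B a b)"
      using a b sub[OF u] by (simp add: mult_eq lambda_add v_def)
    also have "\<dots> = (a \<oplus> v \<oplus> \<ominus> a) \<oplus> (a \<otimes> b)"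
      using a b sub[OF v] by (simp add: mult_eq plus.m_assoc lambda_closed)
        (simp add: lambda_closed flip: plus.m_assoc)
    finally show ?thesis
      unfolding w_def using abs[OF conj[OF a v], of "a \<otimes> b"] a b by simp
  qed
  have "(\<Union>c\<in>I +> a. \<Union>d\<in>I +> b. I +> c \<otimes> d) = (\<Union>x\<in>I. \<Union>y\<in>I. I +> ((x \<oplus> a) \<otimes> (y \<oplus> b)))"
    by (auto simp: a_r_coset_def')
  also have "\<dots> = I +> (a \<otimes> b)"
    using key zero by auto
  finally show ?thesis by (simp add: rcoset_mult_def)
qed

lemma quotient_skew_brace:
  assumes I: "brace_ideal I B"
  shows "skew_brace (B Quot I)"
proof -
  have nm: "I \<lhd> add_monoid B" and sgp: "subgroup I (add_monoid B)"
    using I by (auto simp: brace_ideal_def subbrace_def)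
  have car: "carrier (B Quot I) = (\<lambda>x. I +> x) ` carrier B"
    by (auto simp: FactRing_def A_RCOSETS_def')
  have mult: "(I +> a) \<otimes>\<^bsub>B Quot I\<^esub> (I +> b) = I +> (a \<otimes> b)"
    if "a \<in> carrier B" "b \<in> carrier B" for a b
    using ideal_coset_mult[OF I that] by (simp add: FactRing_def)
  have add: "(I +> a) \<oplus>\<^bsub>B Quot I\<^esub> (I +> b) = I +> (a \<oplus> b)"
    if "a \<in> carrier B" "b \<in> carrier B" for a b
    using normal.rcos_sum[OF nm, of a b] that by (simp add: FactRing_def a_r_coset_def set_add_def)
  have one: "\<one>\<^bsub>B Quot I\<^esub> = I +> \<one>" by (simp add: FactRing_def)
  have zero: "\<zero>\<^bsub>B Quot I\<^esub> = I +> \<zero>"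
    using group.coset_join2[OF add_group _ sgp, of \<zero>] subgroup.one_closed[OF sgp]
    by (simp add: FactRing_def a_r_coset_def)
  have ag: "group (add_monoid (B Quot I))"
  proof (rule groupI)
    fix x assume "x \<in> carrier (add_monoid (B Quot I))"
    then obtain a where "a \<in> carrier B" "x = I +> a" by (auto simp: car)
    then show "\<exists>y\<in>carrier (add_monoid (B Quot I)).
        y \<otimes>\<^bsub>add_monoid (B Quot I)\<^esub> x = \<one>\<^bsub>add_monoid (B Quot I)\<^esub>"
      by (auto simp: car add zero intro!: bexI[of _ "\<ominus> a"])
  qed (auto simp: car add zero plus.m_assoc)
  have mg: "group (B Quot I)"
  proof (rule groupI)
    fix x assume "x \<in> carrier (B Quot I)"
    then obtain a where "a \<in> carrier B" "x = I +> a" by (auto simp: car)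
    then show "\<exists>y\<in>carrier (B Quot I). y \<otimes>\<^bsub>B Quot I\<^esub> x = \<one>\<^bsub>B Quot I\<^esub>"
      by (auto simp: car mult one intro!: bexI[of _ "inv a"])
  qed (auto simp: car mult one times.m_assoc)
  have uminus: "\<ominus>\<^bsub>B Quot I\<^esub> (I +> a) = I +> (\<ominus> a)" if "a \<in> carrier B" for a
    unfolding a_inv_def[of "B Quot I"]
    by (rule group.inv_equality[OF ag]) (use that in \<open>auto simp: car add zero\<close>)
  show ?thesis
    by (rule skew_brace.intro[OF ag mg])
      (auto simp: car add mult uminus a_minus_def brace_distrib)
qed

end

end

theory Submission
  imports Defs "HOL-Algebra.Sylow" "HOL-Algebra.Group_Action" "HOL-Algebra.Multiplicative_Group"
begin

text \<open>
  Write \<open>K\<close> for the kernel of \<open>\<lambda>\<close>, \<open>Z\<close> for the centre of the skew brace \<open>B\<close>, and \<open>Q = (B, \<cdot>) / K\<close>.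
  The map \<open>\<lambda>\<close> lets \<open>Q\<close> act on \<open>(B, +)\<close>, and everything is read off from the commutator subgroup of
  the semidirect product \<open>S\<close> of \<open>(B, +)\<close> by \<open>Q\<close>.  Elements of \<open>Z\<close> commute with \<open>(B, +)\<close> and are fixed by
  \<open>\<lambda>\<close>, so \<open>Z \<times> 1\<close> is central in \<open>S\<close>; its index is \<open>t * |Q| = t\<^sup>2 / |K : Z|\<close>.  The commutators of \<open>S\<close>
  include those of \<open>(B, +)\<close>, the elements \<open>\<lambda>\<^sub>a(b) - b = a * b\<close>, and those of \<open>Q\<close>.  Hence
  \<open>N \<times> Q' \<subseteq> S'\<close>, where \<open>N\<close> is the additive subgroup generated by the additive commutators and all
  \<open>a * b\<close> (lemma \<open>generate_times_derived_subset\<close>).  Modulo \<open>N\<close> the two operations of \<open>B\<close> agree and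
  are commutative, so \<open>N\<close> is an ideal containing the derived ideal (theorem \<open>derived_ideal_subset\<close>).
  Thus the order of the derived ideal is at most \<open>|S'| / |Q'|\<close>, and the theorem follows from
  Wiegold's bound: a group \<open>G\<close> with a central subgroup \<open>Z\<close> of finite index \<open>n\<close> has
  \<open>|G'| \<le> \<omega>(n)\<close> (theorem \<open>wiegold_bound\<close>).

  Wiegold's bound has three ingredients.  If \<open>n = p\<^sup>e\<close> with \<open>p\<close> prime, then \<open>|G'|\<close> is at most \<open>p\<close> to
  the power \<open>e choose 2\<close>, which equals \<open>\<omega>(n)\<close>: dividing out the commutators with an element \<open>x\<close> that
  is central modulo \<open>Z\<close> costs at most a factor \<open>p\<close> to the power \<open>e - 1\<close> and lowers the exponent of
  the index (lemma \<open>finite_card_derived_of_prime_power_index\<close>).  For general \<open>n\<close>, with \<open>e\<^sub>p\<close> the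
  multiplicity of \<open>p\<close> in \<open>n\<close>, transfer to the subgroups lying over Sylow subgroups of \<open>G / Z\<close> gives
  \<open>|G'| \<le> |(G/Z)'| * (\<Prod>p. p ^ (e\<^sub>p choose 2))\<close> (theorem \<open>card_derived_le_sylow_product\<close>); in
  particular \<open>G'\<close> is finite.

  It remains to compare this product with \<open>\<omega>(n)\<close> when \<open>n\<close> is not a prime power.  Let \<open>l\<close> be the
  least prime divisor of \<open>n\<close>, let \<open>a\<close> be its multiplicity, and let \<open>M\<close> be the logarithm to base \<open>l\<close>
  of the rest of \<open>n\<close>.  If \<open>G / Z\<close> is not perfect, then \<open>|(G/Z)'| \<le> n / l\<close> and taking logarithms
  reduces the comparison to \<open>(a - 1) * (M - 1) \<ge> 0\<close>.  If \<open>G / Z\<close> is perfect, one has to use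
  \<open>|(G/Z)'| = n\<close>, and the comparison holds as soon as \<open>n\<close> has three distinct prime divisors
  or \<open>(a - 1) * (M - 1) \<ge> 1\<close>.  The remaining orders are \<open>l * q\<^sup>b\<close> with \<open>l < q\<close>, and \<open>l\<^sup>a * q\<close> with
  \<open>l < q < l\<^sup>2\<close>; intersecting conjugate Sylow subgroups produces enough normal subgroups to show that
  groups of these orders are not perfect.
\<close>

section \<open>Cosets and indices\<close>

lemma bij_betw_images_same_kernel:
  assumes "\<And>a b. \<lbrakk>a \<in> A; b \<in> A\<rbrakk> \<Longrightarrow> f a = f b \<longleftrightarrow> g a = g b"
  shows "\<exists>h. bij_betw h (f ` A) (g ` A)"
proof
  show "bij_betw (\<lambda>y. g (inv_into A f y)) (f ` A) (g ` A)"
    unfolding bij_betw_def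
  proof
    show "inj_on (\<lambda>y. g (inv_into A f y)) (f ` A)"
      by (rule inj_onI) (metis assms f_inv_into_f inv_into_into)
    have "g (inv_into A f (f a)) = g a" if "a \<in> A" for a
      using assms that by (metis f_inv_into_f imageI inv_into_into)
    then show "(\<lambda>y. g (inv_into A f y)) ` (f ` A) = g ` A"
      by (simp add: image_image cong: image_cong)
  qed
qed

context group
begin

lemma rcos_eq_iff:
  assumes "subgroup H G" "a \<in> carrier G" "b \<in> carrier G"
  shows "H #> a = H #> b \<longleftrightarrow> a \<otimes> inv b \<in> H"
  using assms by (metis is_group rcos_self repr_independence subgroup.rcos_module)

lemma rcosets_image: "rcosets H = (\<lambda>a. H #> a) ` carrier G"
  by (auto simp: RCOSETS_def)

text \<open>For a homomorphism \<open>f\<close> with kernel \<open>D\<close> this is the first isomorphism theorem on the level of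
  cardinalities.  It is stated for arbitrary maps because it is also applied to coset-valued maps
  such as \<open>h \<mapsto> Hxh\<close>.\<close>

lemma bij_betw_rcosets_image:
  assumes "subgroup D G"
    and "\<And>a b. \<lbrakk>a \<in> carrier G; b \<in> carrier G\<rbrakk> \<Longrightarrow> f a = f b \<longleftrightarrow> a \<otimes> inv b \<in> D"
  shows "\<exists>h. bij_betw h (rcosets D) (f ` carrier G)"
  unfolding rcosets_image
  by (rule bij_betw_images_same_kernel) (use assms in \<open>simp add: rcos_eq_iff\<close>)

text \<open>With a fixed representative \<open>r(C)\<close> for every coset \<open>C\<close> of \<open>H\<close>, each coset of \<open>K\<close> can be written
  in exactly one way as \<open>D r(C)\<close> with \<open>D\<close> a coset of \<open>K\<close> inside \<open>H\<close>.  All three groups may be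
  infinite, so counting elements does not suffice.\<close>

lemma bij_betw_rcosets_tower:
  assumes H: "subgroup H G" and K: "subgroup K G" and "K \<subseteq> H"
  shows "\<exists>h. bij_betw h ((rcosets\<^bsub>G\<lparr>carrier := H\<rparr>\<^esub> K) \<times> (rcosets H)) (rcosets K)"
proof
  define r where "r C = (SOME g. g \<in> carrier G \<and> H #> g = C)" for C
  have r: "r C \<in> carrier G" "H #> r C = C" if "C \<in> rcosets H" for C
    using that someI_ex[of "\<lambda>g. g \<in> carrier G \<and> H #> g = C"]
    unfolding r_def RCOSETS_def by auto
  have sub: "H \<subseteq> carrier G" "K \<subseteq> carrier G"
    using H K subgroup.subset by auto
  have D: "\<exists>h\<in>H. D = K #> h" if "D \<in> rcosets\<^bsub>G\<lparr>carrier := H\<rparr>\<^esub> K" for D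
    using that by (auto simp: RCOSETS_def)
  let ?h = "\<lambda>(D, C). D #> r C"
  show "bij_betw ?h ((rcosets\<^bsub>G\<lparr>carrier := H\<rparr>\<^esub> K) \<times> (rcosets H)) (rcosets K)"
    unfolding bij_betw_def
  proof
    show "inj_on ?h ((rcosets\<^bsub>G\<lparr>carrier := H\<rparr>\<^esub> K) \<times> (rcosets H))"
    proof (rule inj_onI, clarify)
      fix D C D' C'
      assume D1: "D \<in> rcosets\<^bsub>G\<lparr>carrier := H\<rparr>\<^esub> K" and D2: "D' \<in> rcosets\<^bsub>G\<lparr>carrier := H\<rparr>\<^esub> K"
        and C: "C \<in> rcosets H" "C' \<in> rcosets H" and eq: "D #> r C = D' #> r C'"
      obtain h h' where h: "h \<in> H" "D = K #> h" "h' \<in> H" "D' = K #> h'"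
        using D[OF D1] D[OF D2] by blast
      have hc: "h \<in> carrier G" "h' \<in> carrier G" using h sub by auto
      have "K #> (h \<otimes> r C) = K #> (h' \<otimes> r C')"
        using eq h hc r C sub by (simp add: coset_mult_assoc)
      then have "h \<otimes> r C \<in> K #> (h' \<otimes> r C')"
        using hc r C K by (metis m_closed rcos_self)
      then obtain k where k: "k \<in> K" "h \<otimes> r C = k \<otimes> (h' \<otimes> r C')"
        by (auto simp: r_coset_def)
      have "H #> (h \<otimes> r C) = C"
        using h hc r C sub coset_join2[OF hc(1) H h(1)] by (metis coset_mult_assoc)
      moreover have "H #> (k \<otimes> (h' \<otimes> r C')) = C'"
      proof -
        have kh: "k \<otimes> h' \<in> H"
          using k h assms subgroup.m_closed by fastforce
        have "H #> (k \<otimes> (h' \<otimes> r C')) = H #> ((k \<otimes> h') \<otimes> r C')"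
          using k hc r C sub by (metis m_assoc subsetD)
        also have "\<dots> = C'"
          using kh r C sub coset_join2[OF _ H kh] by (metis coset_mult_assoc subsetD)
        finally show ?thesis .
      qed
      ultimately have CC: "C = C'" using k(2) by simp
      then have "D #> r C = D' #> r C" using eq by simp
      then have "D #> r C #> inv (r C) = D' #> r C #> inv (r C)" by simp
      then have "D = D'"
        using r C(1) h hc sub by (simp add: coset_mult_assoc r_coset_subset_G m_assoc)
      then show "D = D' \<and> C = C'" using CC by simp
    qed
    show "?h ` ((rcosets\<^bsub>G\<lparr>carrier := H\<rparr>\<^esub> K) \<times> (rcosets H)) = rcosets K"
    proof
      show "?h ` ((rcosets\<^bsub>G\<lparr>carrier := H\<rparr>\<^esub> K) \<times> (rcosets H)) \<subseteq> rcosets K"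
      proof clarify
        fix D C assume "D \<in> rcosets\<^bsub>G\<lparr>carrier := H\<rparr>\<^esub> K" and C: "C \<in> rcosets H"
        then obtain h where "h \<in> H" "D = K #> h" using D by blast
        then show "D #> r C \<in> rcosets K"
          using r[OF C] sub by (metis coset_mult_assoc m_closed rcosetsI subsetD)
      qed
      show "rcosets K \<subseteq> ?h ` ((rcosets\<^bsub>G\<lparr>carrier := H\<rparr>\<^esub> K) \<times> (rcosets H))"
      proof
        fix E assume "E \<in> rcosets K"
        then obtain g where g: "g \<in> carrier G" "E = K #> g" by (auto simp: RCOSETS_def)
        have C: "H #> g \<in> rcosets H" using g sub by (simp add: rcosetsI)
        define h where "h = g \<otimes> inv (r (H #> g))"
        have h: "h \<in> H"
          using r[OF C] g rcos_eq_iff[OF H g(1), of "r (H #> g)"] by (simp add: h_def)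
        then have hG: "h \<in> carrier G" using sub by auto
        have "g = h \<otimes> r (H #> g)" using r[OF C] g by (simp add: h_def m_assoc)
        then have "E = (K #> h) #> r (H #> g)"
          using g r[OF C] hG sub by (metis coset_mult_assoc)
        moreover have "K #> h \<in> rcosets\<^bsub>G\<lparr>carrier := H\<rparr>\<^esub> K"
          using h by (auto simp: RCOSETS_def)
        ultimately show "E \<in> ?h ` ((rcosets\<^bsub>G\<lparr>carrier := H\<rparr>\<^esub> K) \<times> (rcosets H))"
          using C by (auto intro!: image_eqI[of _ _ "(K #> h, H #> g)"])
      qed
    qed
  qed
qed

lemma rcosets_nonempty: "rcosets H \<noteq> {}"
  by (auto simp: RCOSETS_def)

lemma card_rcosets_tower:
  assumes "subgroup H G" "subgroup K G" "K \<subseteq> H"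
  shows "card (rcosets K) = card (rcosets\<^bsub>G\<lparr>carrier := H\<rparr>\<^esub> K) * card (rcosets H)"
  using bij_betw_rcosets_tower[OF assms] by (metis bij_betw_same_card card_cartesian_product)

lemma finite_rcosets_tower:
  assumes "subgroup H G" "subgroup K G" "K \<subseteq> H" "finite (rcosets K)"
  shows "finite (rcosets H)" "finite (rcosets\<^bsub>G\<lparr>carrier := H\<rparr>\<^esub> K)"
proof -
  have "finite ((rcosets\<^bsub>G\<lparr>carrier := H\<rparr>\<^esub> K) \<times> (rcosets H))"
    using bij_betw_rcosets_tower[OF assms(1-3)] assms(4) bij_betw_finite by blast
  then show "finite (rcosets H)" "finite (rcosets\<^bsub>G\<lparr>carrier := H\<rparr>\<^esub> K)"
    using rcosets_nonempty group.rcosets_nonempty[OF subgroup_imp_group[OF assms(1)]]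
    by (metis finite_cartesian_productD1 finite_cartesian_productD2)+
qed

lemma subgroup_eq_if_index_1:
  assumes K: "subgroup K G" and "card (rcosets K) = 1"
  shows "K = carrier G"
proof -
  have "K \<in> rcosets K" using K is_group by (rule subgroup.subgroup_in_rcosets)
  then have "rcosets K = {K}" using assms(2) by (metis card_1_singletonE singletonD)
  then show ?thesis using rcosets_part_G[OF K] by simp
qed

end

section \<open>Groups with a central subgroup of prime power index\<close>

text \<open>The class equation modulo \<open>p\<close>: a conjugacy class has order a power of \<open>p\<close>, so if the class of the
  unit were the only one with a single element, the order of the group would be \<open>1\<close> modulo \<open>p\<close>.\<close>

lemma p_group_centre_nontrivial:
  assumes Q: "group Q" and p: "prime p" and card: "order Q = p ^ Suc e"
  shows "\<exists>x \<in> carrier Q. x \<noteq> \<one>\<^bsub>Q\<^esub> \<and> (\<forall>y \<in> carrier Q. x \<otimes>\<^bsub>Q\<^esub> y = y \<otimes>\<^bsub>Q\<^esub> x)"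
proof (rule ccontr)
  interpret Q: group Q by fact
  define \<phi> where "\<phi> = (\<lambda>g. \<lambda>h \<in> carrier Q. g \<otimes>\<^bsub>Q\<^esub> h \<otimes>\<^bsub>Q\<^esub> (inv\<^bsub>Q\<^esub> g))"
  interpret act: group_action Q "carrier Q" \<phi>
    unfolding \<phi>_def by (rule Q.action_by_conjugation)
  assume contr: "\<not> ?thesis"
  have fin: "finite (carrier Q)"
    using card p by (metis Q.order_gt_0_iff_finite prime_gt_0_nat zero_less_power)
  have orbit_one: "orbit Q \<phi> \<one>\<^bsub>Q\<^esub> = {\<one>\<^bsub>Q\<^esub>}"
    by (auto simp: orbit_def \<phi>_def intro!: exI[of _ "\<one>\<^bsub>Q\<^esub>"])
  have dvd: "p dvd card (orbit Q \<phi> x)" if x: "x \<in> carrier Q" "x \<noteq> \<one>\<^bsub>Q\<^esub>" for x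
  proof -
    have "card (orbit Q \<phi> x) dvd p ^ Suc e"
      using act.orbit_stabilizer_theorem[OF x(1)] card by (metis dvd_triv_left)
    then obtain i where i: "card (orbit Q \<phi> x) = p ^ i"
      using divides_primepow_nat[OF p] by blast
    have "i \<noteq> 0"
    proof
      assume "i = 0"
      then obtain y where "orbit Q \<phi> x = {y}" using i by (auto simp: card_1_singleton_iff)
      moreover have "x \<in> orbit Q \<phi> x" using x act.orbit_refl by simp
      ultimately have orb: "orbit Q \<phi> x = {x}" by auto
      have "x \<otimes>\<^bsub>Q\<^esub> y = y \<otimes>\<^bsub>Q\<^esub> x" if y: "y \<in> carrier Q" for y
      proof -
        have "y \<otimes>\<^bsub>Q\<^esub> x \<otimes>\<^bsub>Q\<^esub> inv\<^bsub>Q\<^esub> y \<in> orbit Q \<phi> x"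
          using x y by (auto simp: orbit_def \<phi>_def)
        then show ?thesis using orb x y
          by (metis Q.inv_solve_right' Q.m_closed singletonD)
      qed
      then show False using contr x by blast
    qed
    then show ?thesis using i by simp
  qed
  let ?O = "orbits Q (carrier Q) \<phi>"
  have "(\<Sum>orb\<in>?O. card orb) = card (carrier Q)"
    using act.disjoint_sum[OF fin, of "\<lambda>_. 1::nat"] by simp
  moreover have one: "{\<one>\<^bsub>Q\<^esub>} \<in> ?O"
    using orbit_one Q.one_closed unfolding orbits_def by blast
  moreover have finO: "finite ?O"
    using fin by (simp add: orbits_def)
  moreover have "p dvd (\<Sum>orb\<in>?O - {{\<one>\<^bsub>Q\<^esub>}}. card orb)"
    by (rule dvd_sum) (use dvd orbit_one in \<open>auto simp: orbits_def\<close>)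
  moreover have "(\<Sum>orb\<in>?O. card orb) = 1 + (\<Sum>orb\<in>?O - {{\<one>\<^bsub>Q\<^esub>}}. card orb)"
    using sum.remove[OF finO one, of card] by simp
  moreover have "p dvd card (carrier Q)"
    using card by (simp add: order_def)
  ultimately have "p dvd 1"
    by (metis dvd_add_left_iff)
  then show False using p by auto
qed

definition (in group) comm :: "'a \<Rightarrow> 'a \<Rightarrow> 'a" where
  "comm x y = x \<otimes> y \<otimes> inv x \<otimes> inv y"

context group
begin

lemma comm_closed [simp]: "\<lbrakk>x \<in> carrier G; y \<in> carrier G\<rbrakk> \<Longrightarrow> comm x y \<in> carrier G"
  by (simp add: comm_def)

lemma mult_swap_comm:
  "\<lbrakk>x \<in> carrier G; y \<in> carrier G\<rbrakk> \<Longrightarrow> x \<otimes> y = comm x y \<otimes> (y \<otimes> x)"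
  by (simp add: comm_def m_assoc) (simp flip: m_assoc)

lemma comm_eqI:
  assumes "x \<in> carrier G" "y \<in> carrier G" "c \<in> carrier G" "x \<otimes> y = c \<otimes> (y \<otimes> x)"
  shows "comm x y = c"
  using assms mult_swap_comm[of x y] by (metis comm_closed m_closed right_cancel)

lemma inv_of_comm:
  "\<lbrakk>x \<in> carrier G; y \<in> carrier G\<rbrakk> \<Longrightarrow> inv (comm x y) = comm y x"
  by (simp add: comm_def inv_mult_group m_assoc)

lemma derived_subset_iff_comm:
  assumes "subgroup K G"
  shows "derived G (carrier G) \<subseteq> K \<longleftrightarrow> (\<forall>x\<in>carrier G. \<forall>y\<in>carrier G. comm x y \<in> K)"
proof
  assume "derived G (carrier G) \<subseteq> K"
  then show "\<forall>x\<in>carrier G. \<forall>y\<in>carrier G. comm x y \<in> K"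
    unfolding derived_def comm_def by (blast intro: generate.incl)
next
  assume "\<forall>x\<in>carrier G. \<forall>y\<in>carrier G. comm x y \<in> K"
  then show "derived G (carrier G) \<subseteq> K"
    unfolding derived_def comm_def by (intro generate_subgroup_incl[OF _ assms]) auto
qed

lemma comm_mult_right:
  assumes "x \<in> carrier G" "a \<in> carrier G" "b \<in> carrier G"
  shows "comm x (a \<otimes> b) = comm x a \<otimes> (a \<otimes> comm x b \<otimes> inv a)"
proof (rule comm_eqI)
  have "x \<otimes> (a \<otimes> b) = comm x a \<otimes> (a \<otimes> (x \<otimes> b))"
    using assms mult_swap_comm[of x a] by (simp add: m_assoc flip: m_assoc[of x a])
  also have "\<dots> = comm x a \<otimes> (a \<otimes> comm x b \<otimes> (b \<otimes> x))"
    using assms mult_swap_comm[of x b] by (simp add: m_assoc)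
  also have "\<dots> = comm x a \<otimes> (a \<otimes> comm x b \<otimes> inv a) \<otimes> (a \<otimes> b \<otimes> x)"
    using assms by (simp add: m_assoc) (simp flip: m_assoc[of "inv a" a])
  finally show "x \<otimes> (a \<otimes> b) = comm x a \<otimes> (a \<otimes> comm x b \<otimes> inv a) \<otimes> (a \<otimes> b \<otimes> x)" .
qed (use assms in auto)

text \<open>This is the preimage of the centre of \<open>G / K\<close>, described without leaving \<open>G\<close>.\<close>

lemma subgroup_centralizer_mod:
  assumes K: "K \<lhd> G"
  shows "subgroup {g \<in> carrier G. \<forall>h \<in> carrier G. comm g h \<in> K} G"
proof -
  interpret K: normal K G by fact
  have swap: "comm g h \<in> K" if "comm h g \<in> K" "g \<in> carrier G" "h \<in> carrier G" for g h
    using that by (metis K.m_inv_closed inv_of_comm)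
  have mult: "comm h (a \<otimes> b) \<in> K"
    if "a \<in> carrier G" "b \<in> carrier G" "h \<in> carrier G" "comm h a \<in> K" "comm h b \<in> K" for a b h
    using that K.inv_op_closed2 by (simp add: comm_mult_right)
  have inv: "comm h (inv a) \<in> K"
    if "a \<in> carrier G" "h \<in> carrier G" "comm h a \<in> K" for a h
  proof -
    have "comm h (inv a) = inv a \<otimes> inv (comm h a) \<otimes> a"
      using that by (simp add: inv_of_comm) (simp add: comm_def m_assoc inv_solve_left)
    then show ?thesis using that K.inv_op_closed1 by simp
  qed
  have "{g \<in> carrier G. \<forall>h \<in> carrier G. comm g h \<in> K} = {g \<in> carrier G. \<forall>h \<in> carrier G. comm h g \<in> K}"
    using swap by blast
  moreover have "subgroup {g \<in> carrier G. \<forall>h \<in> carrier G. comm h g \<in> K} G"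
  proof (rule subgroupI)
    have "\<one> \<in> {g \<in> carrier G. \<forall>h\<in>carrier G. comm h g \<in> K}" by (simp add: comm_def)
    then show "{g \<in> carrier G. \<forall>h\<in>carrier G. comm h g \<in> K} \<noteq> {}" by blast
  qed (simp_all add: mult inv subsetI)
  ultimately show ?thesis by simp
qed

end

text \<open>In particular every subgroup \<open>K\<close> with \<open>N \<subseteq> K \<subseteq> Z\<close> is normal once \<open>[G, Z] \<subseteq> N\<close>.\<close>

lemma (in group) normal_if_comm_mem:
  assumes "subgroup K G" "\<And>k g. \<lbrakk>k \<in> K; g \<in> carrier G\<rbrakk> \<Longrightarrow> comm g k \<in> K"
  shows "K \<lhd> G"
proof (rule normal_invI[OF assms(1)])
  fix x h assume x: "x \<in> carrier G" and h: "h \<in> K"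
  have hc: "h \<in> carrier G" using h assms(1) subgroup.subset by blast
  have "x \<otimes> h \<otimes> inv x = comm x h \<otimes> h"
    using x hc by (simp add: comm_def m_assoc)
  then show "x \<otimes> h \<otimes> inv x \<in> K"
    using assms x h subgroup.m_closed by fastforce
qed

text \<open>The statement is about \<open>G / N\<close>, of which \<open>Z / N\<close> is a central subgroup.  It is phrased inside \<open>G\<close>
  so that the induction may pass to further quotients, which as groups of cosets would
  live on a different type each time.

  If \<open>Z \<noteq> G\<close>, take \<open>x\<close> outside \<open>Z\<close> that is central modulo \<open>Z\<close>.  Since \<open>[x, G] \<subseteq> Z\<close> and \<open>Z\<close> is central
  modulo \<open>N\<close>, the map \<open>g \<mapsto> [x, g]\<close> is a homomorphism modulo \<open>N\<close>; its kernel contains \<open>Z\<close> and \<open>x\<close>, so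
  its image has order at most \<open>p\<close> to the power \<open>e - 1\<close>.  The induction hypothesis is applied to the
  preimage \<open>K\<close> of this image in place of \<open>N\<close>.  Modulo \<open>K\<close> also \<open>x\<close> is central, so the index of the
  centre has dropped, and the exponents \<open>e - 1\<close>, \<open>e - 2\<close>, ... add up to \<open>e choose 2\<close>.\<close>

lemma (in group) finite_card_derived_of_prime_power_index:
  assumes p: "prime p"
    and "subgroup N G" "subgroup Z G" "N \<subseteq> Z" "finite N"
    and "\<And>z g. \<lbrakk>z \<in> Z; g \<in> carrier G\<rbrakk> \<Longrightarrow> comm g z \<in> N"
    and "card (rcosets Z) = p ^ e"
  shows "finite (derived G (carrier G)) \<and> card (derived G (carrier G)) \<le> card N * p ^ (e choose 2)"
  using assms(2-)
proof (induction e arbitrary: N Z rule: less_induct)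
  case (less e)
  note N = \<open>subgroup N G\<close> and Z = \<open>subgroup Z G\<close> and NZ = \<open>N \<subseteq> Z\<close> and comm_Z = less.prems(5)
  have Zc: "Z \<subseteq> carrier G" using Z by (rule subgroup.subset)
  have normal_N: "N \<lhd> G" and normal_Z: "Z \<lhd> G"
    using comm_Z NZ by (auto intro!: normal_if_comm_mem N Z)
  interpret N: normal N G by fact
  interpret Z: normal Z G by fact
  show ?case
  proof (cases e)
    case 0
    then have "Z = carrier G" using subgroup_eq_if_index_1[OF Z] less.prems(6) by simp
    then have "derived G (carrier G) \<subseteq> N" using derived_subset_iff_comm[OF N] comm_Z by simp
    then show ?thesis
      using 0 \<open>finite N\<close> by (auto simp: binomial_eq_0 intro: finite_subset card_mono)
  next
    case (Suc e')
    obtain C where C: "C \<in> carrier (G Mod Z)" "C \<noteq> Z"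
      "\<And>D. D \<in> carrier (G Mod Z) \<Longrightarrow> C <#> D = D <#> C"
      using p_group_centre_nontrivial[OF Z.factorgroup_is_group p, of e'] less.prems(6) Suc
      by (auto simp: order_def FactGroup_def)
    obtain x where x: "x \<in> carrier G" "C = Z #> x"
      using C(1) by (auto simp: carrier_FactGroup)
    have xZ: "x \<notin> Z" using C(2) x coset_join2[OF x(1) Z] by auto
    have comm_x: "comm x g \<in> Z" if g: "g \<in> carrier G" for g
    proof -
      have "Z #> (x \<otimes> g) = Z #> (g \<otimes> x)"
        using C(3)[of "Z #> g"] x g by (simp add: carrier_FactGroup Z.rcos_sum)
      then show ?thesis
        using rcos_eq_iff[OF Z, of "x \<otimes> g" "g \<otimes> x"] x g
        by (simp add: comm_def inv_mult_group m_assoc)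
    qed
    interpret Q: group "G Mod N" by (rule N.factorgroup_is_group)
    define F where "F g = N #> comm x g" for g
    have F_mult: "F (g \<otimes> h) = F g <#> F h" if gh: "g \<in> carrier G" "h \<in> carrier G" for g h
    proof -
      define c where "c = comm x h"
      have c: "c \<in> Z" "c \<in> carrier G" using comm_x gh x by (auto simp: c_def)
      have "N #> (g \<otimes> c \<otimes> inv g) = N #> c"
        using rcos_eq_iff[OF N, of "g \<otimes> c \<otimes> inv g" c] comm_Z[OF c(1) gh(1)] gh c
        by (simp add: comm_def m_assoc)
      then show ?thesis
        using x gh c by (simp add: F_def comm_mult_right flip: c_def N.rcos_sum)
    qed
    have F_hom: "F \<in> hom G (G Mod N)"
      using x by (auto simp: hom_def F_mult carrier_FactGroup) (simp add: F_def)
    interpret F: group_hom G "G Mod N" F by unfold_locales (rule F_hom)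
    define I where "I = F ` carrier G"
    have I: "subgroup I (G Mod N)" unfolding I_def by (rule F.img_is_subgroup)
    define K where "K = \<Union>I"
    have K: "subgroup K G" unfolding K_def by (rule N.factgroup_subgroup_union_subgroup[OF I])
    have K_iff: "k \<in> K \<longleftrightarrow> k \<in> carrier G \<and> N #> k \<in> I" for k
      using N.factgroup_subgroup_union_char[OF I] by (auto simp: K_def)
    have NK: "N \<subseteq> K"
      using N.subset subgroup.one_closed[OF I] coset_join2[OF _ N] by (auto simp: K_iff)
    have KZ: "K \<subseteq> Z"
    proof
      fix k assume "k \<in> K"
      then obtain g where g: "g \<in> carrier G" "k \<in> carrier G" "N #> k = N #> comm x g"
        by (auto simp: K_iff I_def F_def)
      then have "k \<in> N #> comm x g" using rcos_self[OF g(2) N] by simp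
      then obtain n where "n \<in> N" "k = n \<otimes> comm x g" by (auto simp: r_coset_def)
      then show "k \<in> Z" using comm_x g NZ by auto
    qed
    have normal_K: "K \<lhd> G"
      using comm_Z NK KZ by (intro normal_if_comm_mem K) auto
    define W where "W = kernel G (G Mod N) F"
    have W: "subgroup W G" unfolding W_def by (rule F.subgroup_kernel)
    have W_iff: "g \<in> W \<longleftrightarrow> g \<in> carrier G \<and> comm x g \<in> N" for g
      using x coset_join1[OF _ _ N] coset_join2[OF _ N] by (auto simp: W_def kernel_def F_def)
    have ZW: "Z \<subseteq> W" using Zc comm_Z x by (auto simp: W_iff)
    have xW: "x \<in> W" using x by (simp add: W_iff comm_def m_assoc)
    have index_less: "\<exists>i<e. card (rcosets V) = p ^ i" if V: "subgroup V G" "Z \<subseteq> V" "x \<in> V" for V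
    proof -
      have tower: "p ^ e = card (rcosets\<^bsub>G\<lparr>carrier := V\<rparr>\<^esub> Z) * card (rcosets V)"
        using card_rcosets_tower[OF V(1) Z V(2)] less.prems(6) by simp
      then obtain i where i: "i \<le> e" "card (rcosets V) = p ^ i"
        using p by (metis dvd_triv_right divides_primepow_nat)
      have "card (rcosets\<^bsub>G\<lparr>carrier := V\<rparr>\<^esub> Z) \<noteq> 1"
        using group.subgroup_eq_if_index_1[OF subgroup_imp_group[OF V(1)], of Z]
          subgroup_incl[OF Z V(1) V(2)] V(3) xZ by auto
      then have "i \<noteq> e" using tower i p by auto
      then show ?thesis using i le_neq_implies_less by blast
    qed
    have card_K: "finite K" "card K \<le> card N * p ^ e'"
    proof -
      have "F a = F b \<longleftrightarrow> a \<otimes> inv b \<in> W" if "a \<in> carrier G" "b \<in> carrier G" for a b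
        using that by (simp add: W_def kernel_def F.hom_mult F.hom_inv del: one_FactGroup mult_FactGroup)
         (metis F.hom_closed Q.inv_closed Q.inv_equality Q.inv_inv Q.r_inv)
      then obtain h where "bij_betw h (rcosets W) I"
        using bij_betw_rcosets_image[OF W, of F] unfolding I_def by blast
      then have "card I = card (rcosets W)" by (simp add: bij_betw_same_card)
      then obtain i where i: "i < e" "card I = p ^ i" using index_less[OF W ZW xW] by metis
      then have finI: "finite I" using p by (metis card.infinite power_not_zero not_prime_0)
      have I_sub: "I \<subseteq> rcosets N" using subgroup.subset[OF I] by (simp add: FactGroup_def)
      have fin: "finite D" "card D = card N" if "D \<in> I" for D
        using that I_sub N.subset \<open>finite N\<close> rcosets_finite card_rcosets_equal by (metis subsetD)+
      show "finite K" unfolding K_def using finI fin by blast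
      have "card K \<le> (\<Sum>D\<in>I. card D)" unfolding K_def by (rule card_Union_le_sum_card)
      also have "\<dots> = p ^ i * card N" using fin i by simp
      also have "\<dots> \<le> p ^ e' * card N"
        using i Suc p by (intro mult_right_mono power_increasing) (auto simp: Suc_leI prime_gt_0_nat)
      finally show "card K \<le> card N * p ^ e'" by (simp add: mult.commute)
    qed
    \<comment> \<open>the preimage of the centre of \<open>G / K\<close>; it contains \<open>Z\<close> and \<open>x\<close>, so its index is a smaller power of \<open>p\<close>\<close>
    define Z' where "Z' = {g \<in> carrier G. \<forall>h \<in> carrier G. comm g h \<in> K}"
    have Z': "subgroup Z' G" unfolding Z'_def by (rule subgroup_centralizer_mod[OF normal_K])
    have swap: "comm g h \<in> K" if "comm h g \<in> K" "g \<in> carrier G" "h \<in> carrier G" for g h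
      using that subgroup.m_inv_closed[OF K] inv_of_comm by metis
    have ZZ': "Z \<subseteq> Z'"
    proof
      fix z assume z: "z \<in> Z"
      have "comm z h \<in> K" if "h \<in> carrier G" for h
        by (rule swap) (use z Zc NK comm_Z that in auto)
      then show "z \<in> Z'" using z Zc by (auto simp: Z'_def)
    qed
    have xZ': "x \<in> Z'"
      using x subgroup.one_closed[OF K] by (auto simp: Z'_def K_iff I_def F_def)
    obtain i where i: "i < e" "card (rcosets Z') = p ^ i"
      using index_less[OF Z' ZZ' xZ'] by blast
    have IH: "finite (derived G (carrier G)) \<and> card (derived G (carrier G)) \<le> card K * p ^ (i choose 2)"
    proof (rule less.IH[OF i(1) K Z' _ card_K(1) _ i(2)])
      show "K \<subseteq> Z'" using KZ ZZ' by auto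
      show "comm g z \<in> K" if "z \<in> Z'" "g \<in> carrier G" for z g
        using that swap by (auto simp: Z'_def)
    qed
    have "card K * p ^ (i choose 2) \<le> (card N * p ^ e') * p ^ (e' choose 2)"
      using card_K(2) i(1) Suc p
      by (intro mult_mono power_increasing binomial_right_mono) (auto simp: Suc_leI prime_gt_0_nat intro: binomial_right_mono)
    also have "\<dots> = card N * p ^ (e choose 2)"
      using Suc by (simp add: numeral_2_eq_2 power_add)
    finally show ?thesis using IH by auto
  qed
qed

section \<open>Transfer and the Sylow reduction\<close>

lemma (in comm_group) commutator_trivial:
  assumes "a \<in> carrier G" "b \<in> carrier G"
  shows "a \<otimes> b \<otimes> inv a \<otimes> inv b = \<one>"
  using assms m_comm[of a b] by (metis inv_closed inv_mult_group m_assoc m_closed r_inv)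

context group
begin

text \<open>The transfer \<open>V : G \<rightarrow> P / P'\<close> sends \<open>g\<close> to the product over all cosets \<open>C\<close> of \<open>P\<close> of the classes of
  \<open>t(C) g t(Cg)\<^sup>-\<^sup>1\<close>, where \<open>t\<close> selects representatives.  Its target is abelian, so it kills \<open>G'\<close>.  On
  a central \<open>z \<in> P\<close> every factor equals \<open>z\<close>, so \<open>V(z)\<close> is the class of \<open>z\<close> to the power \<open>|G : P|\<close>.\<close>

theorem transfer_central:
  assumes P: "subgroup P G" and fin: "finite (rcosets P)"
    and z: "z \<in> P" "\<And>g. g \<in> carrier G \<Longrightarrow> z \<otimes> g = g \<otimes> z" "z \<in> derived G (carrier G)"
  shows "z [^] card (rcosets P) \<in> derived G P"
proof -
  define D where "D = derived G P"
  define A where "A = (G\<lparr>carrier := P\<rparr>) Mod D"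
  interpret P: subgroup P G by fact
  interpret PG: group "G\<lparr>carrier := P\<rparr>" using P by (rule subgroup_imp_group)
  interpret A: comm_group A
    unfolding A_def D_def by (rule derived_quot_of_subgroup_is_comm_group[OF P])
  interpret D: normal D "G\<lparr>carrier := P\<rparr>"
    unfolding D_def by (rule derived_subgroup_is_normal[OF P])
  have D: "subgroup D G" unfolding D_def by (rule derived_is_subgroup[OF P.subset])
  have A_carrier: "D #> x \<in> carrier A" if "x \<in> P" for x
    using that by (auto simp: A_def carrier_FactGroup)
  have A_mult: "(D #> x) \<otimes>\<^bsub>A\<^esub> (D #> y) = D #> (x \<otimes> y)" if "x \<in> P" "y \<in> P" for x y
    using D.rcos_sum[of x y] that by (simp add: A_def)
  have A_one: "\<one>\<^bsub>A\<^esub> = D" by (simp add: A_def)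
  define t where "t C = (SOME g. g \<in> C)" for C :: "'a set"
  have t: "t C \<in> carrier G" "P #> t C = C" if C: "C \<in> rcosets P" for C
  proof -
    obtain g where g: "g \<in> carrier G" "C = P #> g" using C by (auto simp: RCOSETS_def)
    have "t C \<in> C" unfolding t_def using g P rcos_self by (metis someI)
    then show "t C \<in> carrier G" "P #> t C = C"
      using g P repr_independence r_coset_subset_G[OF P.subset g(1)] by auto
  qed
  have move: "C #> g \<in> rcosets P" if "C \<in> rcosets P" "g \<in> carrier G" for C g
    using that P.subset by (auto simp: RCOSETS_def coset_mult_assoc) 
  \<comment> \<open>the element of \<open>P\<close> by which \<open>t C g\<close> differs from the representative of its coset\<close>
  define h where "h C g = t C \<otimes> g \<otimes> inv (t (C #> g))" for C g
  have h: "h C g \<in> P" if "C \<in> rcosets P" "g \<in> carrier G" for C g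
  proof -
    have "P #> (t C \<otimes> g) = P #> t (C #> g)"
      using t[OF that(1)] t[OF move[OF that]] that P.subset by (metis coset_mult_assoc)
    then show ?thesis
      unfolding h_def
      by (subst rcos_eq_iff[OF P, symmetric]) (use t(1)[OF that(1)] t(1)[OF move[OF that]] that in auto)
  qed
  have h_mult: "h C (g \<otimes> g') = h C g \<otimes> h (C #> g) g'"
    if "C \<in> rcosets P" "g \<in> carrier G" "g' \<in> carrier G" for C g g'
  proof -
    have "C \<subseteq> carrier G" using that(1) P.rcosets_carrier is_group by blast
    then have eq: "C #> g #> g' = C #> (g \<otimes> g')"
      using that by (simp add: coset_mult_assoc)
    note [simp] = t(1)[OF that(1)] t(1)[OF move[OF that(1,2)]] that
      t(1)[OF move[OF that(1) m_closed[OF that(2,3)]]]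
    show ?thesis
      unfolding h_def eq by (simp add: m_assoc) (simp flip: m_assoc)
  qed
  have move_inj: "inj_on (\<lambda>C. C #> g) (rcosets P)" if g: "g \<in> carrier G" for g
  proof (rule inj_on_inverseI)
    fix C assume "C \<in> rcosets P"
    then have "C \<subseteq> carrier G" using P.rcosets_carrier is_group by blast
    then show "C #> g #> inv g = C" using g by (simp add: coset_mult_assoc)
  qed
  have move_image: "(\<lambda>C. C #> g) ` (rcosets P) = rcosets P" if g: "g \<in> carrier G" for g
    using move_inj[OF g] move[OF _ g] fin by (intro endo_inj_surj) auto
  define V where "V g = finprod A (\<lambda>C. D #> h C g) (rcosets P)" for g
  have V_mult: "V (g \<otimes> g') = V g \<otimes>\<^bsub>A\<^esub> V g'" if g: "g \<in> carrier G" "g' \<in> carrier G" for g g'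
  proof -
    have "V (g \<otimes> g') = finprod A (\<lambda>C. (D #> h C g) \<otimes>\<^bsub>A\<^esub> (D #> h (C #> g) g')) (rcosets P)"
      unfolding V_def
      by (rule A.finprod_cong') (use g h move h_mult A_mult A_carrier A.m_closed in auto)
    also have "\<dots> = V g \<otimes>\<^bsub>A\<^esub> finprod A (\<lambda>C. D #> h (C #> g) g') (rcosets P)"
      unfolding V_def by (rule A.finprod_multf) (use g h move A_carrier in auto)
    also have "finprod A (\<lambda>C. D #> h (C #> g) g') (rcosets P) = V g'"
      unfolding V_def
      using A.finprod_reindex[of "\<lambda>C. D #> h C g'" "\<lambda>C. C #> g" "rcosets P"]
        move_inj[OF g(1)] move_image[OF g(1)] g h A_carrier by auto
    finally show ?thesis .
  qed
  have V_hom: "V \<in> hom G A"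
    using V_mult h A_carrier by (auto simp: hom_def V_def intro!: A.finprod_closed)
  interpret V: group_hom G A V by unfold_locales (rule V_hom)
  have "derived G (carrier G) \<subseteq> kernel G A V"
    unfolding derived_def
    by (intro generate_subgroup_incl[OF _ V.subgroup_kernel]) (auto simp: kernel_def A.commutator_trivial)
  then have "V z = D" using z(3) by (auto simp: kernel_def A_one)
  moreover have "V z = D #> (z [^] card (rcosets P))"
  proof -
    have zG: "z \<in> carrier G" using z(1) P.subset by auto
    have hz: "h C z = z" if C: "C \<in> rcosets P" for C
    proof -
      have "C #> z = P #> (t C \<otimes> z)"
        using t[OF C] zG P.subset by (metis coset_mult_assoc)
      also have "\<dots> = P #> (z \<otimes> t C)" using z(2) t[OF C] by simp
      also have "\<dots> = C"
        using t[OF C] zG P.subset coset_join2[OF zG P z(1)] by (metis coset_mult_assoc)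
      finally show ?thesis
        using t[OF C] zG z(2)[of "t C"] by (simp add: h_def) (simp flip: z(2) add: m_assoc)
    qed
    have "V z = finprod A (\<lambda>C. D #> z) (rcosets P)"
      unfolding V_def by (rule A.finprod_cong') (use hz A_carrier z(1) in auto)
    also have "\<dots> = (D #> z) [^]\<^bsub>A\<^esub> card (rcosets P)"
      by (rule A.finprod_const) (use A_carrier z(1) in auto)
    also have "\<dots> = D #> (z [^] card (rcosets P))"
    proof -
      have "(D #> z) [^]\<^bsub>A\<^esub> k = D #> (z [^] k) \<and> z [^] k \<in> P" for k :: nat
      proof (induction k)
        case 0
        then show ?case using subgroup.subset[OF D] by (simp add: A_one)
      next
        case (Suc k)
        then show ?case using A_mult z(1) by simp
      qed
      then show ?thesis by simp
    qed
    finally show ?thesis .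
  qed
  ultimately have "D #> (z [^] card (rcosets P)) = D" by simp
  moreover have "z [^] card (rcosets P) \<in> carrier G" using z(1) P.subset by auto
  ultimately show ?thesis using coset_join1[OF _ _ D] by (simp add: D_def)
qed

end

lemma group_hom_quotient:
  assumes "N \<lhd> G" shows "group_hom G (G Mod N) ((#>\<^bsub>G\<^esub>) N)"
  using assms by (simp add: group_hom_def group_hom_axioms_def normal.factorgroup_is_group 
    normal.r_coset_hom_Mod normal.axioms(2))

context group
begin

lemma finite_card_derived_of_prime_power_index_central:
  assumes p: "prime p" and Z: "subgroup Z G"
    and central: "\<And>z g. \<lbrakk>z \<in> Z; g \<in> carrier G\<rbrakk> \<Longrightarrow> z \<otimes> g = g \<otimes> z"
    and "card (rcosets Z) = p ^ e"
  shows "finite (derived G (carrier G))" "card (derived G (carrier G)) \<le> p ^ (e choose 2)"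
proof -
  have "comm g z = \<one>" if "z \<in> Z" "g \<in> carrier G" for z g
    using that central[OF that] subgroup.subset[OF Z] by (intro comm_eqI) auto
  then have "finite (derived G (carrier G)) \<and> card (derived G (carrier G)) \<le> card {\<one>} * p ^ (e choose 2)"
    using assms(4) triv_subgroup subgroup.one_closed[OF Z]
    by (intro finite_card_derived_of_prime_power_index[OF p _ Z]) auto
  then show "finite (derived G (carrier G))" "card (derived G (carrier G)) \<le> p ^ (e choose 2)"
    by auto
qed

lemma normal_of_centralizes:
  assumes Z: "subgroup Z G"
    and central: "\<And>z g. \<lbrakk>z \<in> Z; g \<in> carrier G\<rbrakk> \<Longrightarrow> z \<otimes> g = g \<otimes> z"
  shows "Z \<lhd> G"
proof (rule normal_invI[OF Z])
  fix x z assume "x \<in> carrier G" "z \<in> Z"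
  then show "x \<otimes> z \<otimes> inv x \<in> Z"
    using central[of z x] subgroup.subset[OF Z] by (metis inv_solve_right' m_closed subsetD)
qed

lemma sylow_over_central:
  assumes Z: "subgroup Z G"
    and central: "\<And>z g. \<lbrakk>z \<in> Z; g \<in> carrier G\<rbrakk> \<Longrightarrow> z \<otimes> g = g \<otimes> z"
    and index: "card (rcosets Z) = p ^ e * m" and p: "prime p" and "0 < m"
  obtains P where "subgroup P G" "Z \<subseteq> P" "card (rcosets P) = m"
    "finite (derived G P)" "card (derived G P) \<le> p ^ (e choose 2)"
proof -
  have normal: "Z \<lhd> G" by (rule normal_of_centralizes[OF Z central])
  interpret Z: normal Z G by (rule normal)
  have pos: "0 < p ^ e" using p by (simp add: prime_gt_0_nat)
  have fin: "finite (rcosets Z)"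
    using index pos \<open>0 < m\<close> by (metis card.infinite mult_pos_pos less_irrefl)
  obtain S where S: "subgroup S (G Mod Z)" "card S = p ^ e"
    using sylow_thm[OF p Z.factorgroup_is_group, of e m] index fin
    by (auto simp: order_def FactGroup_def)
  define P where "P = \<Union>S"
  have P: "subgroup P G" unfolding P_def by (rule Z.factgroup_subgroup_union_subgroup[OF S(1)])
  have card_S: "card (rcosets\<^bsub>G\<lparr>carrier := P\<rparr>\<^esub> Z) = p ^ e"
    using Z.factgroup_subgroup_union_factor[OF S(1)] S(2) by (simp add: P_def)
  have ZP: "Z \<subseteq> P"
    using subgroup.one_closed[OF S(1)] by (auto simp: P_def)
  show thesis
  proof
    show "subgroup P G" "Z \<subseteq> P" by (rule P, rule ZP)
    show "card (rcosets P) = m"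
      using card_rcosets_tower[OF P Z ZP] card_S index prime_gt_0_nat[OF p] by simp
    have d: "derived (G\<lparr>carrier := P\<rparr>) (carrier (G\<lparr>carrier := P\<rparr>)) = derived G P"
      using derived_consistent[OF _ P] by simp
    have Z': "subgroup Z (G\<lparr>carrier := P\<rparr>)" by (rule subgroup_incl[OF Z P ZP])
    note * = group.finite_card_derived_of_prime_power_index_central[OF subgroup_imp_group[OF P] p Z' _ card_S,
        unfolded d]
    show "finite (derived G P)" "card (derived G P) \<le> p ^ (e choose 2)"
      by (rule *; use central subgroup.subset[OF P] in auto)+
  qed
qed

text \<open>For each prime \<open>p\<close> dividing \<open>n\<close> let \<open>P\<close> lie over a Sylow \<open>p\<close>-subgroup of \<open>G / Z\<close>.  By transfer, raising
  to the power \<open>m\<^sub>p = |G : P|\<close> maps \<open>G' \<inter> Z\<close> into \<open>P'\<close>, whose order is bounded by the prime power case.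
  The numbers \<open>m\<^sub>p\<close> have no common prime factor, so an element of \<open>G' \<inter> Z\<close> is determined by these
  powers.  In particular \<open>G' \<inter> Z\<close> is finite.\<close>

lemma card_derived_inter_centre_le:
  assumes Z: "subgroup Z G"
    and central: "\<And>z g. \<lbrakk>z \<in> Z; g \<in> carrier G\<rbrakk> \<Longrightarrow> z \<otimes> g = g \<otimes> z"
    and fin: "finite (rcosets Z)" 
  defines "n \<equiv> card (rcosets Z)"
  defines "T \<equiv> derived G (carrier G) \<inter> Z"
  shows "finite T" "card T \<le> (\<Prod>p\<in>prime_factors n. p ^ (multiplicity p n choose 2))"
proof -
  have n: "0 < n" unfolding n_def using fin rcosets_nonempty by (simp add: card_gt_0_iff)
  have T: "subgroup T G"
    unfolding T_def by (rule subgroups_Inter_pair[OF derived_is_subgroup Z]) simp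
  have Tc: "T \<subseteq> carrier G" using T by (rule subgroup.subset)
  define m where "m p = n div p ^ multiplicity p n" for p
  have m: "n = p ^ multiplicity p n * m p" "\<not> p dvd m p" "0 < m p" if "p \<in> prime_factors n" for p
  proof -
    show *: "n = p ^ multiplicity p n * m p" by (simp add: m_def multiplicity_dvd)
    show "0 < m p" using * n by (metis gr0I mult_0_right less_irrefl)
    have "p \<noteq> 1" using that by (metis in_prime_factors_iff not_prime_1)
    then show "\<not> p dvd m p"
      unfolding m_def by (intro multiplicity_decompose) (use n in auto)
  qed
  have "\<exists>P. subgroup P G \<and> Z \<subseteq> P \<and> card (rcosets P) = m p \<and> finite (derived G P)
      \<and> card (derived G P) \<le> p ^ (multiplicity p n choose 2)" if p: "p \<in> prime_factors n" for p
    using sylow_over_central[OF Z central m(1)[OF p, unfolded n_def] _ m(3)[OF p]] p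
    unfolding n_def by (metis in_prime_factors_iff)
  then obtain P where P: "\<And>p. p \<in> prime_factors n \<Longrightarrow> subgroup (P p) G \<and> Z \<subseteq> P p \<and>
      card (rcosets (P p)) = m p \<and> finite (derived G (P p)) \<and>
      card (derived G (P p)) \<le> p ^ (multiplicity p n choose 2)"
    by metis
  define \<phi> where "\<phi> z = (\<lambda>p \<in> prime_factors n. z [^] m p)" for z
  let ?E = "PiE (prime_factors n) (\<lambda>p. derived G (P p))"
  have im: "\<phi> ` T \<subseteq> ?E"
  proof clarify
    fix z assume z: "z \<in> T"
    have "z [^] m p \<in> derived G (P p)" if p: "p \<in> prime_factors n" for p
    proof -
      have "finite (rcosets (P p))"
        using P[OF p] m(3)[OF p] by (metis card.infinite less_irrefl)
      then show ?thesis
        using transfer_central[of "P p" z] P[OF p] z central by (auto simp: T_def)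
    qed
    then show "\<phi> z \<in> ?E" by (auto simp: \<phi>_def)
  qed
  have inj: "inj_on \<phi> T"
  proof (rule inj_onI)
    fix z w assume z: "z \<in> T" and w: "w \<in> T" and eq: "\<phi> z = \<phi> w"
    have c: "z \<in> carrier G" "w \<in> carrier G" using z w Tc by auto
    define a where "a = z \<otimes> inv w"
    have a: "a \<in> T" unfolding a_def using T z w by (simp add: subgroup.m_closed subgroup.m_inv_closed)
    then have ac: "a \<in> carrier G" using Tc by auto
    have zw: "z \<otimes> inv w = inv w \<otimes> z" using central[of z "inv w"] z c by (simp add: T_def)
    have pow: "a [^] m p = \<one>" if p: "p \<in> prime_factors n" for p
    proof -
      have "z [^] m p = w [^] m p" using eq p by (metis \<phi>_def restrict_apply')
      then show ?thesis
        unfolding a_def using pow_mult_distrib[OF zw c(1) inv_closed[OF c(2)]] c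
        by (simp add: nat_pow_inv)
    qed
    have "ord a = 1"
    proof (rule ccontr)
      assume "ord a \<noteq> 1"
      then obtain q where q: "prime q" "q dvd ord a" by (metis prime_factor_nat)
      show False
      \<comment> \<open>for \<open>n = 1\<close> there are no primes to test with, but then \<open>G\<close> is abelian\<close>
      proof (cases "n = 1")
        case True
        then have "Z = carrier G" using subgroup_eq_if_index_1[OF Z] by (simp add: n_def)
        then have "comm_group G" using central by (intro group_comm_groupI) auto
        then have "a = \<one>" using a comm_group.derived_eq_singleton[of G "carrier G"] by (auto simp: T_def)
        then show False using \<open>ord a \<noteq> 1\<close> by simp
      next
        case False
        then obtain p where p: "p \<in> prime_factors n"
          using n by (metis in_prime_factors_iff less_irrefl prime_factor_nat)
        have dvd: "ord a dvd m p" if "p \<in> prime_factors n" for p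
          using pow[OF that] pow_eq_id[OF ac] by simp
        have "q dvd n" using dvd[OF p] q(2) m(1)[OF p] by (metis dvd_mult dvd_trans)
        then have "q \<in> prime_factors n" using q n by (simp add: in_prime_factors_iff)
        then show False using dvd q(2) m(2) dvd_trans by blast
      qed
    qed
    then have "a = \<one>" using ac ord_eq_1 by simp
    then show "z = w" using c unfolding a_def by (metis inv_equality inv_inv inv_closed)
  qed
  have finE: "finite ?E" using P by (intro finite_PiE) auto
  show "finite T" using inj_on_finite[OF inj im finE] .
  have "card T \<le> card ?E" by (rule card_inj_on_le[OF inj im finE])
  also have "card ?E = (\<Prod>p\<in>prime_factors n. card (derived G (P p)))" by (simp add: card_PiE)
  also have "\<dots> \<le> (\<Prod>p\<in>prime_factors n. p ^ (multiplicity p n choose 2))"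
    using P by (intro prod_mono) auto
  finally show "card T \<le> (\<Prod>p\<in>prime_factors n. p ^ (multiplicity p n choose 2))" .
qed

text \<open>The image of \<open>G'\<close> in \<open>G / Z\<close> is \<open>(G/Z)'\<close>, and the fibres are cosets of \<open>G' \<inter> Z\<close>.\<close>

theorem card_derived_le_sylow_product:
  assumes Z: "subgroup Z G"
    and central: "\<And>z g. \<lbrakk>z \<in> Z; g \<in> carrier G\<rbrakk> \<Longrightarrow> z \<otimes> g = g \<otimes> z"
    and fin: "finite (rcosets Z)" 
  defines "n \<equiv> card (rcosets Z)"
  shows "finite (derived G (carrier G))"
    and "card (derived G (carrier G)) \<le> card (derived (G Mod Z) (carrier (G Mod Z))) *
      (\<Prod>p\<in>prime_factors n. p ^ (multiplicity p n choose 2))"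
proof -
  let ?K = "derived G (carrier G)"
  define T where "T = ?K \<inter> Z"
  note T = card_derived_inter_centre_le[OF Z central fin, folded T_def n_def]
  have K: "subgroup ?K G" by (simp add: derived_is_subgroup)
  have normal: "Z \<lhd> G" by (rule normal_of_centralizes[OF Z central])
  interpret \<pi>: group_hom G "G Mod Z" "(#>) Z" by (rule group_hom_quotient[OF normal])
  have image: "derived (G Mod Z) (carrier (G Mod Z)) = (#>) Z ` ?K"
    using \<pi>.derived_img[of "carrier G"] by (simp add: carrier_FactGroup)
  define I where "I = (#>) Z ` ?K"
  have finI: "finite I"
  proof (rule finite_subset[OF _ fin])
    show "I \<subseteq> rcosets Z"
      unfolding I_def using subgroup.subset[OF K] by (auto simp: RCOSETS_def)
  qed
  define r where "r C = (SOME k. k \<in> ?K \<and> Z #> k = C)" for C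
  have r: "r C \<in> ?K" "Z #> r C = C" if "C \<in> I" for C
    using that someI_ex[of "\<lambda>k. k \<in> ?K \<and> Z #> k = C"] unfolding I_def r_def by auto
  have cover: "?K \<subseteq> (\<Union>C\<in>I. (\<lambda>t. t \<otimes> r C) ` T)"
  proof
    fix k assume k: "k \<in> ?K"
    define C where "C = Z #> k"
    have C: "C \<in> I" unfolding I_def C_def using k by blast
    have kc: "k \<in> carrier G" "r C \<in> carrier G" using k r[OF C] subgroup.subset[OF K] by auto
    have "k \<otimes> inv (r C) \<in> Z"
      using r[OF C] rcos_eq_iff[OF Z kc] by (simp add: C_def)
    moreover have "k \<otimes> inv (r C) \<in> ?K"
      using k r[OF C] K by (simp add: subgroup.m_closed subgroup.m_inv_closed)
    moreover have "k = k \<otimes> inv (r C) \<otimes> r C" using kc by (simp add: m_assoc)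
    ultimately show "k \<in> (\<Union>C\<in>I. (\<lambda>t. t \<otimes> r C) ` T)"
      using C unfolding T_def by blast
  qed
  have finU: "finite (\<Union>C\<in>I. (\<lambda>t. t \<otimes> r C) ` T)" using finI T(1) by auto
  show "finite ?K" using cover finU by (rule finite_subset)
  have "card ?K \<le> card (\<Union>C\<in>I. (\<lambda>t. t \<otimes> r C) ` T)" by (rule card_mono[OF finU cover])
  also have "\<dots> \<le> (\<Sum>C\<in>I. card ((\<lambda>t. t \<otimes> r C) ` T))" by (rule card_UN_le[OF finI])
  also have "\<dots> \<le> (\<Sum>C\<in>I. card T)" by (intro sum_mono card_image_le T(1))
  also have "\<dots> = card I * card T" by simp
  also have "\<dots> \<le> card I * (\<Prod>p\<in>prime_factors n. p ^ (multiplicity p n choose 2))"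
    using T(2) by simp
  finally show "card ?K \<le> card (derived (G Mod Z) (carrier (G Mod Z))) *
      (\<Prod>p\<in>prime_factors n. p ^ (multiplicity p n choose 2))"
    unfolding image I_def .
qed

end

section \<open>Orders of perfect groups\<close>

context group
begin

lemma subgroup_conj_preimage:
  assumes H: "subgroup H G" and x: "x \<in> carrier G"
  shows "subgroup {g \<in> carrier G. x \<otimes> g \<otimes> inv x \<in> H} G"
proof (rule subgroupI)
  have "\<one> \<in> {g \<in> carrier G. x \<otimes> g \<otimes> inv x \<in> H}"
    using x subgroup.one_closed[OF H] by simp
  then show "{g \<in> carrier G. x \<otimes> g \<otimes> inv x \<in> H} \<noteq> {}" by blast
next
  fix a assume a: "a \<in> {g \<in> carrier G. x \<otimes> g \<otimes> inv x \<in> H}"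
  have "inv (x \<otimes> a \<otimes> inv x) = x \<otimes> inv a \<otimes> inv x"
    using a x by (simp add: inv_mult_group m_assoc)
  then show "inv a \<in> {g \<in> carrier G. x \<otimes> g \<otimes> inv x \<in> H}"
    using a subgroup.m_inv_closed[OF H] by fastforce
next
  fix a b assume ab: "a \<in> {g \<in> carrier G. x \<otimes> g \<otimes> inv x \<in> H}"
    "b \<in> {g \<in> carrier G. x \<otimes> g \<otimes> inv x \<in> H}"
  have "(x \<otimes> a \<otimes> inv x) \<otimes> (x \<otimes> b \<otimes> inv x) = x \<otimes> (a \<otimes> b) \<otimes> inv x"
    using ab x by (simp add: m_assoc) (simp flip: m_assoc[of "inv x" x])
  then show "a \<otimes> b \<in> {g \<in> carrier G. x \<otimes> g \<otimes> inv x \<in> H}"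
    using ab subgroup.m_closed[OF H] by fastforce
qed auto

lemma card_conj_preimage:
  assumes H: "subgroup H G" and x: "x \<in> carrier G"
  shows "card {g \<in> carrier G. x \<otimes> g \<otimes> inv x \<in> H} = card H"
proof (rule bij_betw_same_card)
  show "bij_betw (\<lambda>g. x \<otimes> g \<otimes> inv x) {g \<in> carrier G. x \<otimes> g \<otimes> inv x \<in> H} H"
    unfolding bij_betw_def
  proof
    show "inj_on (\<lambda>g. x \<otimes> g \<otimes> inv x) {g \<in> carrier G. x \<otimes> g \<otimes> inv x \<in> H}"
      using x by (auto intro!: inj_onI)
    have "h \<in> (\<lambda>g. x \<otimes> g \<otimes> inv x) ` {g \<in> carrier G. x \<otimes> g \<otimes> inv x \<in> H}" if h: "h \<in> H" for h
    proof (rule image_eqI[of _ _ "inv x \<otimes> h \<otimes> x"])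
      have hc: "h \<in> carrier G" using h subgroup.subset[OF H] by auto
      show "h = x \<otimes> (inv x \<otimes> h \<otimes> x) \<otimes> inv x"
        using conjugation_is_surj[OF x hc] by simp
      then show "inv x \<otimes> h \<otimes> x \<in> {g \<in> carrier G. x \<otimes> g \<otimes> inv x \<in> H}"
        using h hc x by auto
    qed
    then show "(\<lambda>g. x \<otimes> g \<otimes> inv x) ` {g \<in> carrier G. x \<otimes> g \<otimes> inv x \<in> H} = H" by auto
  qed
qed

text \<open>The index of \<open>H \<inter> x\<^sup>-\<^sup>1Hx\<close> in \<open>H\<close> counts the cosets \<open>Hxh\<close> in the double coset \<open>HxH\<close>, and the coset \<open>H\<close>
  itself is not among them when \<open>x\<close> lies outside \<open>H\<close>.\<close>

lemma index_conj_inter_less: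
  assumes H: "subgroup H G" and fin: "finite (rcosets H)" and x: "x \<in> carrier G" "x \<notin> H"
  defines "D \<equiv> {h \<in> H. x \<otimes> h \<otimes> inv x \<in> H}"
  shows "subgroup D (G\<lparr>carrier := H\<rparr>)" 
    and "card (rcosets\<^bsub>G\<lparr>carrier := H\<rparr>\<^esub> D) < card (rcosets H)"
proof -
  interpret H: subgroup H G by fact
  interpret HG: group "G\<lparr>carrier := H\<rparr>" using H by (rule subgroup_imp_group)
  have D_eq: "D = H \<inter> {g \<in> carrier G. x \<otimes> g \<otimes> inv x \<in> H}"
    unfolding D_def using H.subset by blast
  have DG: "subgroup D G"
    unfolding D_eq by (rule subgroups_Inter_pair[OF H subgroup_conj_preimage[OF H x(1)]])
  show D: "subgroup D (G\<lparr>carrier := H\<rparr>)"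
    by (rule subgroup_incl[OF DG H]) (simp add: D_def)
  have "H #> (x \<otimes> a) = H #> (x \<otimes> b) \<longleftrightarrow> a \<otimes> inv b \<in> D" if ab: "a \<in> H" "b \<in> H" for a b
  proof -
    have "(x \<otimes> a) \<otimes> inv (x \<otimes> b) = x \<otimes> (a \<otimes> inv b) \<otimes> inv x"
      using ab x by (simp add: inv_mult_group m_assoc)
    then show ?thesis
      using ab x rcos_eq_iff[OF H, of "x \<otimes> a" "x \<otimes> b"] by (simp add: D_def)
  qed
  then have "\<exists>f. bij_betw f (rcosets\<^bsub>G\<lparr>carrier := H\<rparr>\<^esub> D) ((\<lambda>h. H #> (x \<otimes> h)) ` carrier (G\<lparr>carrier := H\<rparr>))"
    by (intro HG.bij_betw_rcosets_image[OF D]) (simp add: m_inv_consistent[OF H])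
  then have "card (rcosets\<^bsub>G\<lparr>carrier := H\<rparr>\<^esub> D) = card ((\<lambda>h. H #> (x \<otimes> h)) ` H)"
    by (auto dest: bij_betw_same_card)
  moreover have "(\<lambda>h. H #> (x \<otimes> h)) ` H \<subset> rcosets H"
  proof
    show "(\<lambda>h. H #> (x \<otimes> h)) ` H \<subseteq> rcosets H"
      using x H.subset by (auto intro!: rcosetsI)
    have "H \<in> rcosets H" using H.subgroup_in_rcosets is_group by blast
    moreover have "H \<notin> (\<lambda>h. H #> (x \<otimes> h)) ` H"
    proof
      assume "H \<in> (\<lambda>h. H #> (x \<otimes> h)) ` H"
      then obtain h where h: "h \<in> H" "H #> (x \<otimes> h) = H" by auto
      then have "x \<otimes> h \<in> H" using coset_join1[OF h(2) _ H] x by simp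
      then have "x \<otimes> h \<otimes> inv h \<in> H" using h by simp
      then show False using x h by (simp add: m_assoc)
    qed
    ultimately show "(\<lambda>h. H #> (x \<otimes> h)) ` H \<noteq> rcosets H" by blast
  qed
  ultimately show "card (rcosets\<^bsub>G\<lparr>carrier := H\<rparr>\<^esub> D) < card (rcosets H)"
    using fin by (simp add: psubset_card_mono)
qed

text \<open>For \<open>x\<close> outside \<open>H\<close> the index of \<open>H \<inter> x\<^sup>-\<^sup>1Hx\<close> in \<open>H\<close> divides \<open>|H|\<close> and is smaller than \<open>|G : H|\<close>.  The
  standard application is a subgroup whose index is the smallest prime divisor of the group order.\<close>

lemma normal_of_small_index:
  assumes H: "subgroup H G" and fin: "finite (rcosets H)"
    and small: "\<And>d. \<lbrakk>d dvd card H; d < card (rcosets H)\<rbrakk> \<Longrightarrow> d = 1"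
  shows "H \<lhd> G"
proof (rule normal_invI[OF H])
  fix x h assume x: "x \<in> carrier G" and h: "h \<in> H"
  interpret HG: group "G\<lparr>carrier := H\<rparr>" using H by (rule subgroup_imp_group)
  show "x \<otimes> h \<otimes> inv x \<in> H"
  proof (cases "x \<in> H")
    case True
    then show ?thesis using h H by (simp add: subgroup.m_closed subgroup.m_inv_closed)
  next
    case False
    let ?D = "{h \<in> H. x \<otimes> h \<otimes> inv x \<in> H}"
    note D = index_conj_inter_less[OF H fin x False]
    have "card (rcosets\<^bsub>G\<lparr>carrier := H\<rparr>\<^esub> ?D) * card ?D = card H"
      using HG.lagrange[OF D(1)] by (simp add: order_def)
    then have "card (rcosets\<^bsub>G\<lparr>carrier := H\<rparr>\<^esub> ?D) dvd card H"
      by (rule dvdI[OF sym])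
    then have "card (rcosets\<^bsub>G\<lparr>carrier := H\<rparr>\<^esub> ?D) = 1" using small D(2) by blast
    then have "?D = H" using HG.subgroup_eq_if_index_1[OF D(1)] by simp
    then show ?thesis using h by blast
  qed
qed

text \<open>A special case of the prime power bound: \<open>1 choose 2 = 0\<close>.\<close>

lemma derived_trivial_of_prime_order:
  assumes "prime (order G)"
  shows "derived G (carrier G) = {\<one>}"
proof -
  have fin: "finite (carrier G)"
    using assms by (metis order_gt_0_iff_finite prime_gt_0_nat)
  have "finite (derived G (carrier G)) \<and>
      card (derived G (carrier G)) \<le> card {\<one>} * order G ^ (1 choose 2)"
    using assms card_rcosets_triv[OF fin] triv_subgroup
    by (intro finite_card_derived_of_prime_power_index) (auto simp: comm_def)
  then have "card (derived G (carrier G)) \<le> 1" "finite (derived G (carrier G))"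
    by (auto simp: binomial_eq_0)
  moreover have "\<one> \<in> derived G (carrier G)"
    by (simp add: derived_is_subgroup subgroup.one_closed)
  ultimately show ?thesis
    by (metis card_le_Suc0_iff_eq is_singletonI' is_singleton_the_elem One_nat_def empty_iff singletonD)
qed

lemma perfect_quotient:
  assumes "derived G (carrier G) = carrier G" and N: "N \<lhd> G"
  shows "derived (G Mod N) (carrier (G Mod N)) = carrier (G Mod N)"
proof -
  interpret N: normal N G by fact
  interpret \<pi>: group_hom G "G Mod N" "(#>) N"
    by (simp add: group_hom_def group_hom_axioms_def is_group N.factorgroup_is_group N.r_coset_hom_Mod)
  show ?thesis
    using \<pi>.derived_img[of "carrier G"] assms(1) by (simp add: carrier_FactGroup)
qed

lemma perfect_no_normal_prime_index:
  assumes "derived G (carrier G) = carrier G" and N: "N \<lhd> G"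
  shows "\<not> prime (card (rcosets N))"
proof
  assume prime: "prime (card (rcosets N))"
  interpret Q: group "G Mod N" using N by (rule normal.factorgroup_is_group)
  have ord: "order (G Mod N) = card (rcosets N)" by (simp add: order_def FactGroup_def)
  have "carrier (G Mod N) = {\<one>\<^bsub>G Mod N\<^esub>}"
    using Q.derived_trivial_of_prime_order prime ord perfect_quotient[OF assms] by simp
  then have "order (G Mod N) = 1" by (simp add: order_def)
  then show False using prime ord by (metis not_prime_1)
qed

lemma divisor_of_larger_prime_power:
  fixes p q :: nat
  assumes "prime q" "p \<le> q" "d dvd q ^ b" "d < p"
  shows "d = 1"
proof -
  obtain i where i: "d = q ^ i" using assms divides_primepow_nat by blast
  have "q \<le> q ^ i" if "0 < i"
    using that assms(1) self_le_power[of q i] prime_ge_1_nat[of q] by simp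
  then show ?thesis using assms i by (cases "i = 0") auto
qed

text \<open>A Sylow \<open>q\<close>-subgroup has index \<open>p\<close>, the smallest prime divisor of the order, and so is normal with
  an abelian quotient.\<close>

lemma not_perfect_order_prime_times_larger_prime_power:
  assumes p: "prime p" and q: "prime q" and "p < q" and ord: "order G = p * q ^ b"
  shows "derived G (carrier G) \<noteq> carrier G"
proof
  assume perfect: "derived G (carrier G) = carrier G"
  have pos: "0 < p" "0 < q ^ b" using p q by (auto simp: prime_gt_0_nat)
  then have fin: "finite (carrier G)" using ord order_gt_0_iff_finite by simp
  obtain H where H: "subgroup H G" "card H = q ^ b"
    using sylow_thm[OF q is_group, of b p] ord fin by (auto simp: mult.commute)
  have index: "card (rcosets H) = p" using lagrange[OF H(1)] H(2) ord pos prime_gt_0_nat[OF q] by simp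
  then have finr: "finite (rcosets H)" using pos card_ge_0_finite by metis
  have "H \<lhd> G"
    by (rule normal_of_small_index[OF H(1) finr])
      (use divisor_of_larger_prime_power[OF q, of p] \<open>p < q\<close> H index in auto)
  then show False using perfect_no_normal_prime_index[OF perfect] index p by blast
qed

text \<open>A Sylow \<open>p\<close>-subgroup \<open>S\<close> has prime index \<open>q\<close>, so it is not normal in a perfect group.  Let \<open>D\<close> be its
  intersection with a different conjugate \<open>T\<close>.  The index of \<open>D\<close> in \<open>S\<close> is a power of \<open>p\<close> below
  \<open>q < p\<^sup>2\<close>, hence equal to \<open>p\<close>.  Therefore \<open>D\<close> is normal in \<open>S\<close> and in \<open>T\<close>, and its normalizer is the
  whole group, because \<open>S\<close> has prime index.  The quotient by \<open>D\<close> has order \<open>p * q\<close>.\<close>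

lemma not_perfect_order_prime_power_times_prime:
  assumes p: "prime p" and q: "prime q" and "p < q" "q < p\<^sup>2" and ord: "order G = p ^ a * q"
  shows "derived G (carrier G) \<noteq> carrier G"
proof
  assume perfect: "derived G (carrier G) = carrier G"
  have pos: "0 < q" "0 < p ^ a" using p q by (auto simp: prime_gt_0_nat)
  then have fin: "finite (carrier G)" using ord order_gt_0_iff_finite by simp
  obtain S where S: "subgroup S G" "card S = p ^ a"
    using sylow_thm[OF p is_group ord fin] by blast
  interpret S: subgroup S G by (rule S)
  have index: "card (rcosets S) = q" using lagrange[OF S(1)] S(2) ord pos prime_gt_0_nat[OF p] by simp
  then have finr: "finite (rcosets S)" using pos card_ge_0_finite by metis
  have "\<not> S \<lhd> G" using perfect_no_normal_prime_index[OF perfect] index q by blast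
  then obtain x h where x: "x \<in> carrier G" and h: "h \<in> S" "x \<otimes> h \<otimes> inv x \<notin> S"
    using normal_invI[OF S(1)] by blast
  have xS: "x \<notin> S" using h by auto
  define D where "D = {h \<in> S. x \<otimes> h \<otimes> inv x \<in> S}"
  note D = index_conj_inter_less[OF S(1) finr x xS, folded D_def]
  have DG: "subgroup D G" 
    using D(1) S(1) incl_subgroup by blast
  interpret SG: group "G\<lparr>carrier := S\<rparr>" using S(1) by (rule subgroup_imp_group)
  have lag: "card (rcosets\<^bsub>G\<lparr>carrier := S\<rparr>\<^esub> D) * card D = p ^ a"
    using SG.lagrange[OF D(1)] S(2) by (simp add: order_def)
  then obtain i where i: "card (rcosets\<^bsub>G\<lparr>carrier := S\<rparr>\<^esub> D) = p ^ i"
    using divides_primepow_nat[OF p] by (metis dvd_triv_left)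
  have "p ^ i < p ^ 2" using D(2) i index \<open>q < p\<^sup>2\<close> by simp
  then have "i < 2" using p by (metis power_less_imp_less_exp prime_gt_1_nat)
  moreover have "i \<noteq> 0"
  proof
    assume "i = 0"
    then have "D = S" using i SG.subgroup_eq_if_index_1[OF D(1)] by simp
    then show False using h by (auto simp: D_def)
  qed
  ultimately have index_D: "card (rcosets\<^bsub>G\<lparr>carrier := S\<rparr>\<^esub> D) = p" using i by (simp add: less_2_cases_iff)
  have D_small: "d = 1" if "d dvd card D" "d < p" for d
  proof (rule divisor_of_larger_prime_power[OF p _ _ that(2)])
    show "d dvd p ^ a" using that(1) lag by (metis dvd_mult)
  qed simp
  have normal_D: "D \<lhd> G\<lparr>carrier := T\<rparr>"
    if T: "subgroup T G" "card T = p ^ a" "D \<subseteq> T" for T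
  proof -
    interpret TG: group "G\<lparr>carrier := T\<rparr>" using T(1) by (rule subgroup_imp_group)
    have sub: "subgroup D (G\<lparr>carrier := T\<rparr>)" by (rule subgroup_incl[OF DG T(1,3)])
    have "card (rcosets\<^bsub>G\<lparr>carrier := T\<rparr>\<^esub> D) * card D = p * card D"
      using TG.lagrange[OF sub] T(2) lag index_D by (simp add: order_def)
    moreover have "card D \<noteq> 0" using lag pos by (metis mult_0_right less_irrefl)
    ultimately have index_T: "card (rcosets\<^bsub>G\<lparr>carrier := T\<rparr>\<^esub> D) = p" by simp
    show ?thesis
    proof (rule TG.normal_of_small_index[OF sub])
      show "finite (rcosets\<^bsub>G\<lparr>carrier := T\<rparr>\<^esub> D)"
        using index_T p by (metis card.infinite not_prime_0)
    qed (use D_small index_T in auto)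
  qed
  define N where "N = {g \<in> carrier G. \<forall>d \<in> D. g \<otimes> d \<otimes> inv g \<in> D \<and> inv g \<otimes> d \<otimes> g \<in> D}"
  have Dc: "d \<in> carrier G" if "d \<in> D" for d using that subgroup.subset[OF DG] by auto
  have N: "subgroup N G"
  proof (rule subgroupI)
    have "\<one> \<in> N" using Dc by (simp add: N_def)
    then show "N \<noteq> {}" by blast
  next
    fix a b assume ab: "a \<in> N" "b \<in> N"
    then have abc: "a \<in> carrier G" "b \<in> carrier G" by (auto simp: N_def)
    have "(a \<otimes> b) \<otimes> d \<otimes> inv (a \<otimes> b) \<in> D \<and> inv (a \<otimes> b) \<otimes> d \<otimes> (a \<otimes> b) \<in> D" if d: "d \<in> D" for d
    proof -
      have "(a \<otimes> b) \<otimes> d \<otimes> inv (a \<otimes> b) = a \<otimes> (b \<otimes> d \<otimes> inv b) \<otimes> inv a"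
        "inv (a \<otimes> b) \<otimes> d \<otimes> (a \<otimes> b) = inv b \<otimes> (inv a \<otimes> d \<otimes> a) \<otimes> b"
        using abc Dc[OF d] by (simp_all add: inv_mult_group m_assoc)
      then show ?thesis using ab d by (auto simp: N_def)
    qed
    then show "a \<otimes> b \<in> N" using abc by (simp add: N_def)
  qed (auto simp: N_def)
  have sub_N: "T \<subseteq> N" if T: "subgroup T G" "card T = p ^ a" "D \<subseteq> T" for T
  proof
    fix g assume g: "g \<in> T"
    interpret TD: normal D "G\<lparr>carrier := T\<rparr>" using normal_D[OF T] .
    have "g \<otimes> d \<otimes> inv g \<in> D \<and> inv g \<otimes> d \<otimes> g \<in> D" if "d \<in> D" for d
      using TD.inv_op_closed1[of g d] TD.inv_op_closed2[of g d] g that m_inv_consistent[OF T(1) g] by simp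
    then show "g \<in> N" using g subgroup.subset[OF T(1)] by (auto simp: N_def)
  qed
  have SN: "S \<subseteq> N" by (rule sub_N[OF S]) (auto simp: D_def)
  let ?T = "{g \<in> carrier G. x \<otimes> g \<otimes> inv x \<in> S}"
  have TN: "?T \<subseteq> N"
    by (rule sub_N[OF subgroup_conj_preimage[OF S(1) x]])
      (use card_conj_preimage[OF S(1) x] S(2) Dc in \<open>auto simp: D_def\<close>)
  have "N \<noteq> S"
  proof
    assume "N = S"
    then have "?T \<subseteq> S" using TN by simp
    moreover have "card ?T = card S" by (rule card_conj_preimage[OF S(1) x])
    moreover have "finite S" using S.subset fin finite_subset by blast
    ultimately have "?T = S" by (simp add: card_subset_eq)
    then show False using h by auto
  qed
  have "card (rcosets N) dvd q"
    using card_rcosets_tower[OF N S(1) SN] index by simp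
  moreover have "card (rcosets N) \<noteq> q"
  proof
    assume "card (rcosets N) = q"
    then have "card (rcosets\<^bsub>G\<lparr>carrier := N\<rparr>\<^esub> S) = 1"
      using card_rcosets_tower[OF N S(1) SN] index pos by simp
    then show False
      using group.subgroup_eq_if_index_1[OF subgroup_imp_group[OF N] subgroup_incl[OF S(1) N SN]] \<open>N \<noteq> S\<close>
      by simp
  qed
  ultimately have "N = carrier G"
    using q subgroup_eq_if_index_1[OF N] prime_nat_iff by blast
  then have normal: "D \<lhd> G"
    by (intro normal_invI[OF DG]) (auto simp: N_def)
  have "card (rcosets D) = p * q"
    using card_rcosets_tower[OF S(1) DG] index index_D by (simp add: D_def)
  then have "order (G Mod D) = p * q ^ 1" by (simp add: order_def FactGroup_def)
  from group.not_perfect_order_prime_times_larger_prime_power[OF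
      normal.factorgroup_is_group[OF normal] p q \<open>p < q\<close> this]
  show False using perfect_quotient[OF perfect normal] by simp
qed

end

section \<open>Estimating the product over the primes\<close>

text \<open>The cross terms in the square of the sum are at least \<open>1\<close> each, and there are
  \<open>card R * (card R - 1)\<close> of them.\<close>

lemma sum_squares_add_le_square_sum:
  fixes x :: "'i \<Rightarrow> real"
  assumes "finite R" "\<And>i. i \<in> R \<Longrightarrow> 1 \<le> x i"
  shows "(\<Sum>i\<in>R. (x i)\<^sup>2) + real (card R) * (real (card R) - 1) \<le> (\<Sum>i\<in>R. x i)\<^sup>2"
  using assms
proof (induction R rule: finite_induct)
  case empty
  then show ?case by simp
next
  case (insert j R)
  let ?s = "\<Sum>i\<in>R. x i"
  have "real (card R) \<le> ?s"
    using sum_mono[of R "\<lambda>_. 1" x] insert.prems by simp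
  then have "1 * real (card R) \<le> x j * ?s"
    using insert.prems[of j] by (intro mult_mono) auto
  then show ?case
    using insert by (simp add: power2_sum algebra_simps)
qed

lemma log_prod_powers:
  assumes "0 < b" "b \<noteq> 1" "\<And>i. i \<in> A \<Longrightarrow> 0 < f i" "finite A"
  shows "log b (\<Prod>i\<in>A. f i ^ k i) = (\<Sum>i\<in>A. real (k i) * log b (f i))"
proof -
  have "f i ^ k i \<noteq> 0" if "i \<in> A" for i
    using assms(3)[OF that] by simp
  then have "ln (\<Prod>i\<in>A. f i ^ k i) = (\<Sum>i\<in>A. real (k i) * ln (f i))"
    using assms by (simp add: ln_prod ln_realpow)
  then show ?thesis by (simp add: log_def sum_divide_distrib)
qed

definition least_prime_factor :: "nat \<Rightarrow> nat" where
  "least_prime_factor n = (LEAST p. prime p \<and> p dvd n)"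

lemma least_prime_factor:
  assumes "n \<noteq> 1"
  shows "prime (least_prime_factor n)" "least_prime_factor n dvd n"
    and "\<And>q. \<lbrakk>prime q; q dvd n\<rbrakk> \<Longrightarrow> least_prime_factor n \<le> q"
proof -
  have "\<exists>p. prime p \<and> p dvd n" using assms by (rule prime_factor_nat)
  then have "prime (least_prime_factor n) \<and> least_prime_factor n dvd n"
    unfolding least_prime_factor_def by (rule LeastI_ex)
  then show "prime (least_prime_factor n)" "least_prime_factor n dvd n" by auto
  show "least_prime_factor n \<le> q" if "prime q" "q dvd n" for q
    unfolding least_prime_factor_def using that by (intro Least_le) simp
qed

text \<open>The arithmetic of \<open>n\<close> is measured by logarithms to the base \<open>l\<close> of its least prime factor, which
  occurs with multiplicity \<open>a\<close>.  The set \<open>R\<close> consists of the other prime factors, \<open>e\<close> gives their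
  multiplicities, and \<open>M\<close> is the total logarithm that they contribute.\<close>

context
  fixes n l a :: nat and R :: "nat set" and e :: "nat \<Rightarrow> nat" and M :: real
  assumes n: "1 < n"
  defines "l \<equiv> least_prime_factor n"
    and "R \<equiv> prime_factors n - {least_prime_factor n}"
    and "e \<equiv> \<lambda>q. multiplicity q n"
    and "a \<equiv> multiplicity (least_prime_factor n) n"
    and "M \<equiv> (\<Sum>q\<in>prime_factors n - {least_prime_factor n}.
               real (multiplicity q n) * log (least_prime_factor n) q)"
begin

lemma least_factor: "prime l" "l dvd n" "1 < l" "l \<in> prime_factors n"
  using least_prime_factor[of n] n prime_gt_1_nat by (auto simp: l_def in_prime_factors_iff)

lemma larger_factors: "finite R" "\<And>q. q \<in> R \<Longrightarrow> prime q \<and> q dvd n \<and> l < q \<and> 1 \<le> e q \<and> 1 \<le> log l q"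
proof -
  show "finite R" by (simp add: R_def)
  fix q assume q: "q \<in> R"
  then have *: "prime q" "q dvd n" "q \<noteq> l" by (auto simp: R_def l_def in_prime_factors_iff)
  then have "l < q" using least_prime_factor(3)[of n q] n by (simp add: l_def)
  moreover have "1 \<le> e q"
    using q by (auto simp: e_def R_def prime_factors_multiplicity Suc_le_eq)
  moreover have "1 \<le> log l q" using \<open>l < q\<close> least_factor by simp
  ultimately show "prime q \<and> q dvd n \<and> l < q \<and> 1 \<le> e q \<and> 1 \<le> log l q" using * by simp
qed

lemma prime_factors_split: "prime_factors n = insert l R" "l \<notin> R"
  using least_factor by (auto simp: R_def l_def)

lemma a_ge_1: "1 \<le> a"
  using least_factor(4) by (auto simp: a_def l_def prime_factors_multiplicity Suc_le_eq)

lemma log_n: "log l n = a + M"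
proof -
  have "real n = (\<Prod>p\<in>prime_factors n. real p ^ multiplicity p n)"
    using arg_cong[OF prime_factorization_nat[of n], of real] n by simp
  also have "log l \<dots> = (\<Sum>p\<in>prime_factors n. real (multiplicity p n) * log l p)"
    using least_factor by (intro log_prod_powers) (auto simp: in_prime_factors_iff prime_gt_0_nat)
  also have "\<dots> = a + M"
    using least_factor by (subst sum.remove[of _ l]) (simp_all add: a_def M_def l_def)
  finally show ?thesis .
qed

lemma log_omega: "omega n = real l powr (log l n * (log l n - 1) / 2)"
proof -
  have "real n = real l powr log l n" using least_factor n by simp
  then have "omega n = (real l powr log l n) powr ((log l n - 1) / 2)"
    using n by (simp add: omega_def Let_def l_def least_prime_factor_def)
  then show ?thesis by (simp add: powr_powr)
qed

lemma log_binomial_product: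
  "log l (\<Prod>p\<in>prime_factors n. real p ^ (multiplicity p n choose 2))
     = (real a * (a - 1) + (\<Sum>q\<in>R. (real (e q))\<^sup>2 * log l q) - M) / 2"
proof -
  have choose: "real (k choose 2) = (real k ^ 2 - k) / 2" for k :: nat
  proof -
    have "even (k * (k - 1))" by (cases k) auto
    then have "real (k choose 2) = real (k * (k - 1)) / 2"
      by (simp add: choose_two real_of_nat_div)
    then show ?thesis by (cases k) (auto simp: power2_eq_square algebra_simps)
  qed
  have "log l (\<Prod>p\<in>prime_factors n. real p ^ (multiplicity p n choose 2))
      = (\<Sum>p\<in>prime_factors n. real (multiplicity p n choose 2) * log l p)"
    using least_factor by (intro log_prod_powers) (auto simp: in_prime_factors_iff prime_gt_0_nat)
  also have "\<dots> = real (a choose 2) + (\<Sum>q\<in>R. real (e q choose 2) * log l q)"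
    using prime_factors_split larger_factors(1) least_factor by (simp add: a_def e_def l_def)
  also have "(\<Sum>q\<in>R. real (e q choose 2) * log l q)
      = (\<Sum>q\<in>R. ((real (e q))\<^sup>2 * log l q - e q * log l q) / 2)"
    by (intro sum.cong refl) (simp add: choose field_simps)
  also have "\<dots> = ((\<Sum>q\<in>R. (real (e q))\<^sup>2 * log l q) - M) / 2"
    by (simp add: sum_divide_distrib[symmetric] sum_subtractf M_def R_def e_def l_def)
  also have "real (a choose 2) = real a * (a - 1) / 2" using a_ge_1 by (simp add: choose power2_eq_square of_nat_diff field_simps)
  finally show ?thesis by (simp add: field_simps)
qed

text \<open>To base \<open>l\<close>, the logarithm of \<open>\<omega>(n)\<close> is \<open>(a + M) * (a + M - 1) / 2\<close>.  The terms \<open>a * (a - 1)\<close> and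
  \<open>- M\<close> occur on both sides of the comparison, and the hypothesis is what remains.\<close>

lemma scaled_product_le_omega:
  assumes c: "0 < c" and le: "2 * log l c + (\<Sum>q\<in>R. (real (e q))\<^sup>2 * log l q) \<le> 2 * a * M + M\<^sup>2"
  shows "c * (\<Prod>p\<in>prime_factors n. real p ^ (multiplicity p n choose 2)) \<le> omega n"
proof -
  let ?P = "\<Prod>p\<in>prime_factors n. real p ^ (multiplicity p n choose 2)"
  have P: "0 < ?P" by (intro prod_pos) (auto simp: in_prime_factors_iff prime_gt_0_nat)
  have "log l (c * ?P) = log l c + log l ?P" using c P least_factor by (simp add: log_mult)
  also have "\<dots> \<le> log l n * (log l n - 1) / 2"
    using le a_ge_1 unfolding log_n log_binomial_product
    by (simp add: of_nat_diff power2_eq_square field_simps)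
  finally have "c * ?P \<le> l powr (log l n * (log l n - 1) / 2)"
    using c P least_factor by (subst (asm) log_le_iff) auto
  then show ?thesis by (simp add: log_omega)
qed

text \<open>The summands of \<open>M\<close> are the numbers \<open>e q * log l q \<ge> 1\<close>, and \<open>(log l q)\<^sup>2 \<ge> log l q\<close> since \<open>q > l\<close>.\<close>

lemma M_square_ge: "(\<Sum>q\<in>R. (real (e q))\<^sup>2 * log l q) + real (card R) * (real (card R) - 1) \<le> M\<^sup>2"
proof -
  have "(real (e q))\<^sup>2 * log l q \<le> (e q * log l q)\<^sup>2" if "q \<in> R" for q
    using larger_factors(2)[OF that] by (simp add: power_mult_distrib mult_left_mono self_le_power)
  then have "(\<Sum>q\<in>R. (real (e q))\<^sup>2 * log l q) \<le> (\<Sum>q\<in>R. (e q * log l q)\<^sup>2)" by (rule sum_mono)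
  moreover have "1 \<le> e q * log l q" if "q \<in> R" for q
    using mult_mono[of 1 "real (e q)" 1 "log l q"] larger_factors(2)[OF that] by simp
  ultimately show ?thesis
    using sum_squares_add_le_square_sum[OF larger_factors(1), of "\<lambda>q. e q * log l q"]
    by (simp add: M_def R_def e_def l_def)
qed

lemma M_ge_1: "R \<noteq> {} \<Longrightarrow> 1 \<le> M"
proof -
  assume "R \<noteq> {}"
  have "1 \<le> e q * log l q" if "q \<in> R" for q
    using mult_mono[of 1 "real (e q)" 1 "log l q"] larger_factors(2)[OF that] by simp
  then have "real (card R) \<le> M"
    using sum_mono[of R "\<lambda>_. 1" "\<lambda>q. e q * log l q"] by (simp add: M_def R_def e_def l_def)
  moreover have "1 \<le> card R" using larger_factors(1) \<open>R \<noteq> {}\<close> by (simp add: Suc_le_eq card_gt_0_iff)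
  ultimately show ?thesis by simp
qed

lemma prime_power_le_omega:
  assumes "R = {}"
  shows "real (l ^ (a choose 2)) \<le> omega n" "n = l ^ a"
proof -
  have M: "M = 0" using assms unfolding M_def R_def by (metis sum.empty)
  show "real (l ^ (a choose 2)) \<le> omega n"
    using scaled_product_le_omega[of 1] assms M prime_factors_split by (simp add: a_def l_def)
  show "n = l ^ a"
    using prime_factorization_nat[of n] n prime_factors_split assms by (simp add: a_def l_def)
qed

text \<open>The factor \<open>n / l\<close> bounds the order of a proper subgroup of a group of order \<open>n\<close>.\<close>

lemma proper_le_omega:
  assumes "R \<noteq> {}"
  shows "real n / l * (\<Prod>p\<in>prime_factors n. real p ^ (multiplicity p n choose 2)) \<le> omega n"
proof (rule scaled_product_le_omega)
  show "0 < real n / l" using n least_factor by simp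
  have "0 \<le> real (card R) * (real (card R) - 1)" by (cases "card R") auto
  moreover have "0 \<le> (real a - 1) * (M - 1)" using a_ge_1 M_ge_1[OF assms] by simp
  moreover have "log l (n / l) = a + M - 1" using n least_factor by (simp add: log_divide flip: log_n)
  ultimately show "2 * log l (n / l) + (\<Sum>q\<in>R. (real (e q))\<^sup>2 * log l q) \<le> 2 * a * M + M\<^sup>2"
    using M_square_ge by (simp add: algebra_simps)
qed

text \<open>The factor \<open>n\<close> is needed for perfect quotients.  Compared with the factor \<open>n / l\<close>, the logarithm
  grows by \<open>1\<close>, and either alternative of the hypothesis makes up for it.\<close>

lemma full_le_omega:
  assumes "2 \<le> card R \<or> (R \<noteq> {} \<and> 2 \<le> a \<and> 2 \<le> M)"
  shows "real n * (\<Prod>p\<in>prime_factors n. real p ^ (multiplicity p n choose 2)) \<le> omega n"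
proof (rule scaled_product_le_omega)
  show "0 < real n" using n by simp
  let ?r = "real (card R)"
  have "2 \<le> 2 * (real a - 1) * (M - 1) + ?r * (?r - 1)"
    using assms
  proof
    assume r: "2 \<le> card R"
    then have "R \<noteq> {}" by auto
    then have "0 \<le> (real a - 1) * (M - 1)" using a_ge_1 M_ge_1 by simp
    moreover have "2 * 1 \<le> ?r * (?r - 1)" using r by (intro mult_mono) auto
    ultimately show ?thesis unfolding mult.assoc by linarith
  next
    assume *: "R \<noteq> {} \<and> 2 \<le> a \<and> 2 \<le> M"
    then have "1 * 1 \<le> (real a - 1) * (M - 1)" by (intro mult_mono) auto
    moreover have "0 \<le> ?r * (?r - 1)" by (cases "card R") auto
    ultimately show ?thesis unfolding mult.assoc by linarith
  qed
  then show "2 * log l n + (\<Sum>q\<in>R. (real (e q))\<^sup>2 * log l q) \<le> 2 * a * M + M\<^sup>2"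
    using M_square_ge by (simp add: log_n algebra_simps)
qed

end

section \<open>Wiegold's bound\<close>

text \<open>If the index \<open>n\<close> is not a prime power, the Sylow product is compared with \<open>\<omega>(n)\<close> according to whether
  \<open>G / Z\<close> is perfect.  When it is and \<open>n\<close> has only two prime divisors, \<open>n = l\<^sup>a * q\<^sup>b\<close>, the numerical
  lemma \<open>full_le_omega\<close> requires \<open>a \<ge> 2\<close> and \<open>b * log l q \<ge> 2\<close>.  The second condition fails only for
  \<open>b = 1\<close> and \<open>q < l\<^sup>2\<close>; these cases and \<open>a = 1\<close> are excluded by the results on orders of perfect groups.\<close>

theorem (in group) wiegold_bound:
  assumes Z: "subgroup Z G"
    and central: "\<And>z g. \<lbrakk>z \<in> Z; g \<in> carrier G\<rbrakk> \<Longrightarrow> z \<otimes> g = g \<otimes> z"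
    and fin: "finite (rcosets Z)"
  shows "finite (derived G (carrier G))"
    and "real (card (derived G (carrier G))) \<le> omega (card (rcosets Z))"
proof -
  define n where "n = card (rcosets Z)"
  define l where "l = least_prime_factor n"
  define a where "a = multiplicity l n"
  define R where "R = prime_factors n - {l}"
  let ?Q = "G Mod Z"
  let ?\<Pi> = "\<Prod>p\<in>prime_factors n. p ^ (multiplicity p n choose 2)"
  note bound = card_derived_le_sylow_product[OF Z central fin, folded n_def]
  show "finite (derived G (carrier G))" by (rule bound(1))
  have n0: "0 < n" unfolding n_def using fin rcosets_nonempty by (simp add: card_gt_0_iff)
  have normal: "Z \<lhd> G" by (rule normal_of_centralizes[OF Z central])
  interpret Q: group ?Q using normal by (rule normal.factorgroup_is_group)
  have ord: "order ?Q = n" by (simp add: order_def FactGroup_def n_def)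
  have "real (card (derived G (carrier G))) \<le> omega n"
  proof (cases "n = 1")
    case True
    then have "card (derived G (carrier G)) \<le> 1 ^ (0 choose 2)"
      using finite_card_derived_of_prime_power_index_central(2)[OF two_is_prime_nat Z central, of 0]
      by (simp add: n_def binomial_eq_0)
    then show ?thesis using True by (simp add: omega_def)
  next
    case False
    then have n: "1 < n" using n0 by simp
    note least_factor = least_factor[OF n, folded l_def]
    note larger_factors = larger_factors[OF n, folded l_def, folded R_def]
    show ?thesis
    proof (cases "R = {}")
      case True
      note pp = prime_power_le_omega[OF n, folded l_def, folded R_def a_def, OF True]
      have "card (derived G (carrier G)) \<le> l ^ (a choose 2)"
        using pp(2) unfolding n_def
        by (intro finite_card_derived_of_prime_power_index_central(2)[OF least_factor(1) Z central]) 
      then have "real (card (derived G (carrier G))) \<le> real (l ^ (a choose 2))"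
        by (rule of_nat_mono)
      then show ?thesis using pp(1) by (rule order_trans)
    next
      case False
      let ?d = "card (derived ?Q (carrier ?Q))"
      have d: "subgroup (derived ?Q (carrier ?Q)) ?Q" by (simp add: Q.derived_is_subgroup)
      have "real (card (derived G (carrier G))) \<le> real ?d * real ?\<Pi>"
        using of_nat_mono[OF bound(2), where 'a = real] by simp
      also have "\<dots> \<le> omega n"
      proof (cases "derived ?Q (carrier ?Q) = carrier ?Q")
        case perfect: True
        have "2 \<le> card R \<or> (R \<noteq> {} \<and> 2 \<le> a \<and> 2 \<le> (\<Sum>q\<in>R. real (multiplicity q n) * log l q))"
        proof (rule disjCI)
          assume "\<not> (R \<noteq> {} \<and> 2 \<le> a \<and> 2 \<le> (\<Sum>q\<in>R. real (multiplicity q n) * log l q))"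
          then have contr: "\<not> (2 \<le> a \<and> 2 \<le> (\<Sum>q\<in>R. real (multiplicity q n) * log l q))"
            using False by simp
          show "2 \<le> card R"
          proof (rule ccontr)
            assume "\<not> 2 \<le> card R"
            moreover have "card R \<noteq> 0" using False larger_factors(1) by simp
            ultimately have "card R = 1" by simp
            then obtain q where Rq: "R = {q}" by (auto simp: card_1_singleton_iff)
            define b where "b = multiplicity q n"
            have q: "prime q" "l < q" "1 \<le> b" "1 \<le> log l q"
              using larger_factors(2)[of q] Rq by (auto simp: b_def)
            have a1: "1 \<le> a" using a_ge_1[OF n] by (simp add: a_def l_def)
            have pf: "prime_factors n = {l, q}" using least_factor(4) Rq by (auto simp: R_def)
            have n_eq: "n = l ^ a * q ^ b"
              using prime_factorization_nat[of n] n0 q(2) unfolding pf by (simp add: a_def b_def)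
            have "a \<noteq> 1"
              using Q.not_perfect_order_prime_times_larger_prime_power[OF least_factor(1) q(1,2), of b]
                ord n_eq perfect by auto
            then have a2: "2 \<le> a" using a1 by simp
            then have M: "b * log l q < 2" using contr Rq by (simp add: b_def)
            have "b < 2"
            proof (rule ccontr)
              assume "\<not> b < 2"
              then have "2 * 1 \<le> b * log l q" using q(4) by (intro mult_mono) auto
              then show False using M by simp
            qed
            then have b: "b = 1" using q(3) by simp
            then have "log l q < log l (real l ^ 2)"
              using M least_factor by (simp add: log_nat_power)
            then have "q < l\<^sup>2"
              using least_factor q by (subst (asm) log_less_cancel_iff) (auto simp flip: of_nat_power)
            then show False
              using Q.not_perfect_order_prime_power_times_prime[OF least_factor(1) q(1,2), of a]
                ord n_eq b perfect by auto
          qed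
        qed
        then have "real n * real ?\<Pi> \<le> omega n"
          using full_le_omega[OF n, folded l_def, folded R_def a_def] by simp
        moreover have "?d = n" using perfect ord by (simp add: order_def)
        ultimately show ?thesis by simp
      next
        case notperfect: False
        let ?i = "card (rcosets\<^bsub>?Q\<^esub> derived ?Q (carrier ?Q))"
        have i: "?i * ?d = n" using Q.lagrange[OF d] ord by simp
        have "?i \<noteq> 1" using Q.subgroup_eq_if_index_1[OF d] notperfect by blast
        then obtain q where q: "prime q" "q dvd ?i" using prime_factor_nat by blast
        have "q dvd n" using dvd_mult2[OF q(2), of ?d] i by simp
        then have "l \<le> q" using least_prime_factor(3)[of n q] q(1) n by (simp add: l_def)
        also have "q \<le> ?i"
        proof (rule dvd_imp_le[OF q(2)])
          show "0 < ?i" using i n0 by (metis gr0I mult_0)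
        qed
        finally have "l \<le> ?i" .
        then have "l * ?d \<le> n" using i by (metis mult_le_mono1)
        then have "real (l * ?d) \<le> real n" by (rule of_nat_mono)
        then have "real ?d \<le> real n / l" using least_factor by (simp add: field_simps)
        then have "real ?d * real ?\<Pi> \<le> real n / l * real ?\<Pi>" by (rule mult_right_mono) (rule of_nat_0_le_iff)
        also have "\<dots> \<le> omega n"
          using proper_le_omega[OF n, folded l_def, folded R_def, OF False] by simp
        finally show ?thesis .
      qed
      finally show ?thesis .
    qed
  qed
  then show "real (card (derived G (carrier G))) \<le> omega (card (rcosets Z))" by (simp add: n_def)
qed

section \<open>Semidirect products\<close>

definition semidirect_product ::
  "('a, 'm) monoid_scheme \<Rightarrow> ('b, 'n) monoid_scheme \<Rightarrow> ('b \<Rightarrow> 'a \<Rightarrow> 'a) \<Rightarrow> ('a \<times> 'b) monoid" where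
  "semidirect_product A H \<phi> =
     \<lparr>carrier = carrier A \<times> carrier H,
      monoid.mult = (\<lambda>(a, h) (b, k). (a \<otimes>\<^bsub>A\<^esub> \<phi> h b, h \<otimes>\<^bsub>H\<^esub> k)),
      one = (\<one>\<^bsub>A\<^esub>, \<one>\<^bsub>H\<^esub>)\<rparr>"

locale semidirect = A: group A + H: group H
  for A (structure) and H (structure) +
  fixes \<phi> :: "'c \<Rightarrow> 'a \<Rightarrow> 'a"
  assumes act_hom: "h \<in> carrier H \<Longrightarrow> \<phi> h \<in> hom A A"
    and act_one: "a \<in> carrier A \<Longrightarrow> \<phi> \<one>\<^bsub>H\<^esub> a = a"
    and act_mult: "\<lbrakk>h \<in> carrier H; k \<in> carrier H; a \<in> carrier A\<rbrakk> \<Longrightarrow> \<phi> (h \<otimes>\<^bsub>H\<^esub> k) a = \<phi> h (\<phi> k a)"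
begin

abbreviation S where "S \<equiv> semidirect_product A H \<phi>"

lemma act_closed [simp]: "\<lbrakk>h \<in> carrier H; a \<in> carrier A\<rbrakk> \<Longrightarrow> \<phi> h a \<in> carrier A"
  using act_hom by (auto simp: hom_def)

lemma act_times:
  "\<lbrakk>h \<in> carrier H; a \<in> carrier A; b \<in> carrier A\<rbrakk> \<Longrightarrow> \<phi> h (a \<otimes>\<^bsub>A\<^esub> b) = \<phi> h a \<otimes>\<^bsub>A\<^esub> \<phi> h b"
  using act_hom by (auto simp: hom_def)

lemma act_unit: "h \<in> carrier H \<Longrightarrow> \<phi> h \<one>\<^bsub>A\<^esub> = \<one>\<^bsub>A\<^esub>"
  using act_hom hom_one A.is_group by blast

lemma carrier_S [simp]: "carrier S = carrier A \<times> carrier H"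
  and mult_S [simp]: "(a, h) \<otimes>\<^bsub>S\<^esub> (b, k) = (a \<otimes>\<^bsub>A\<^esub> \<phi> h b, h \<otimes>\<^bsub>H\<^esub> k)"
  and one_S [simp]: "\<one>\<^bsub>S\<^esub> = (\<one>\<^bsub>A\<^esub>, \<one>\<^bsub>H\<^esub>)"
  by (auto simp: semidirect_product_def)

lemma group_S: "group S"
proof (rule groupI)
  fix x assume "x \<in> carrier S"
  then obtain a h where x: "x = (a, h)" "a \<in> carrier A" "h \<in> carrier H" by auto
  have "(\<phi> (inv\<^bsub>H\<^esub> h) (inv\<^bsub>A\<^esub> a), inv\<^bsub>H\<^esub> h) \<otimes>\<^bsub>S\<^esub> x = \<one>\<^bsub>S\<^esub>"
    using x by (simp add: act_unit flip: act_times)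
  then show "\<exists>y\<in>carrier S. y \<otimes>\<^bsub>S\<^esub> x = \<one>\<^bsub>S\<^esub>"
    by (rule bexI) (use x in auto)
qed (auto simp: act_times act_mult act_one A.m_assoc H.m_assoc)

sublocale S: group S by (rule group_S)

lemma rcos_times_one:
  assumes "Z \<subseteq> carrier A" "a \<in> carrier A" "h \<in> carrier H"
  shows "(Z \<times> {\<one>\<^bsub>H\<^esub>}) #>\<^bsub>S\<^esub> (a, h) = (Z #>\<^bsub>A\<^esub> a) \<times> {h}"
  using assms by (auto simp: r_coset_def act_one subset_iff)

lemma rcosets_times_one:
  assumes Z: "Z \<subseteq> carrier A"
  shows "rcosets\<^bsub>S\<^esub> (Z \<times> {\<one>\<^bsub>H\<^esub>}) = (\<lambda>(C, h). C \<times> {h}) ` ((rcosets\<^bsub>A\<^esub> Z) \<times> carrier H)"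
proof -
  have "rcosets\<^bsub>S\<^esub> (Z \<times> {\<one>\<^bsub>H\<^esub>}) = (\<lambda>(a, h). (Z #>\<^bsub>A\<^esub> a) \<times> {h}) ` (carrier A \<times> carrier H)"
    unfolding S.rcosets_image carrier_S
    by (rule image_cong) (auto simp: rcos_times_one[OF Z] simp del: insert_Times_insert)
  moreover have "(rcosets\<^bsub>A\<^esub> Z) \<times> carrier H = (\<lambda>(a, h). (Z #>\<^bsub>A\<^esub> a, h)) ` (carrier A \<times> carrier H)"
    unfolding A.rcosets_image by auto
  ultimately show ?thesis
    by (simp add: image_image case_prod_unfold)
qed

lemma card_rcosets_times_one:
  assumes Z: "subgroup Z A"
  shows "card (rcosets\<^bsub>S\<^esub> (Z \<times> {\<one>\<^bsub>H\<^esub>})) = card (rcosets\<^bsub>A\<^esub> Z) * card (carrier H)"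
proof -
  have "C \<noteq> {}" if "C \<in> rcosets\<^bsub>A\<^esub> Z" for C
    using that A.rcos_self[OF _ Z] by (auto simp: RCOSETS_def)
  then have "inj_on (\<lambda>(C, h). C \<times> {h}) ((rcosets\<^bsub>A\<^esub> Z) \<times> carrier H)"
    by (auto intro!: inj_onI simp: times_eq_iff)
  then show ?thesis
    by (simp add: rcosets_times_one subgroup.subset[OF Z] card_image card_cartesian_product)
qed

lemma subgroup_times_one:
  assumes Z: "subgroup Z A"
  shows "subgroup (Z \<times> {\<one>\<^bsub>H\<^esub>}) S"
proof (rule S.subgroupI)
  have sub: "Z \<subseteq> carrier A" using Z by (rule subgroup.subset)
  show "Z \<times> {\<one>\<^bsub>H\<^esub>} \<subseteq> carrier S" using sub by auto
  show "Z \<times> {\<one>\<^bsub>H\<^esub>} \<noteq> {}" using subgroup.one_closed[OF Z] by auto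
  fix x assume "x \<in> Z \<times> {\<one>\<^bsub>H\<^esub>}"
  then obtain z where z: "z \<in> Z" "x = (z, \<one>\<^bsub>H\<^esub>)" by auto
  have "inv\<^bsub>S\<^esub> x = (inv\<^bsub>A\<^esub> z, \<one>\<^bsub>H\<^esub>)"
    by (rule S.inv_equality) (use z sub in \<open>auto simp: act_one\<close>)
  then show "inv\<^bsub>S\<^esub> x \<in> Z \<times> {\<one>\<^bsub>H\<^esub>}" using z subgroup.m_inv_closed[OF Z] by auto
next
  fix x y assume "x \<in> Z \<times> {\<one>\<^bsub>H\<^esub>}" "y \<in> Z \<times> {\<one>\<^bsub>H\<^esub>}"
  then show "x \<otimes>\<^bsub>S\<^esub> y \<in> Z \<times> {\<one>\<^bsub>H\<^esub>}"
    using subgroup.m_closed[OF Z] subgroup.subset[OF Z] by (auto simp: act_one subset_iff)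
qed

text \<open>Inside the semidirect product, \<open>\<phi>\<^sub>h(a) a\<^sup>-\<^sup>1\<close> is the commutator of \<open>h\<close> and \<open>a\<close>, so both kinds of
  generators are commutators.\<close>

lemma generate_times_derived_subset:
  assumes X: "X = {A.comm a b |a b. a \<in> carrier A \<and> b \<in> carrier A} \<union>
    {\<phi> h a \<otimes>\<^bsub>A\<^esub> inv\<^bsub>A\<^esub> a |h a. h \<in> carrier H \<and> a \<in> carrier A}"
  shows "generate A X \<times> derived H (carrier H) \<subseteq> derived S (carrier S)"
proof -
  let ?D = "derived S (carrier S)"
  have D: "subgroup ?D S" by (rule S.derived_is_subgroup) simp
  have comm_D: "S.comm x y \<in> ?D" if "x \<in> carrier S" "y \<in> carrier S" for x y
    using S.derived_subset_iff_comm[OF D] that by blast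
  define N where "N = {a \<in> carrier A. (a, \<one>\<^bsub>H\<^esub>) \<in> ?D}"
  have left: "group_hom A S (\<lambda>a. (a, \<one>\<^bsub>H\<^esub>))"
    by unfold_locales (auto simp: hom_def act_one)
  have right: "group_hom H S (\<lambda>h. (\<one>\<^bsub>A\<^esub>, h))"
    by unfold_locales (auto simp: hom_def act_unit)
  have N: "subgroup N A"
  proof (rule A.subgroupI)
    have "\<one>\<^bsub>A\<^esub> \<in> N" using subgroup.one_closed[OF D] by (simp add: N_def)
    then show "N \<noteq> {}" by blast
    show "inv\<^bsub>A\<^esub> a \<in> N" if "a \<in> N" for a
      using that subgroup.m_inv_closed[OF D, of "(a, \<one>\<^bsub>H\<^esub>)"] group_hom.hom_inv[OF left, of a] by (auto simp: N_def)
    show "a \<otimes>\<^bsub>A\<^esub> b \<in> N" if "a \<in> N" "b \<in> N" for a b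
      using that subgroup.m_closed[OF D, of "(a, \<one>\<^bsub>H\<^esub>)" "(b, \<one>\<^bsub>H\<^esub>)"] by (auto simp: N_def act_one)
  qed (auto simp: N_def)
  have "X \<subseteq> N"
  proof -
    have "A.comm a b \<in> N" if ab: "a \<in> carrier A" "b \<in> carrier A" for a b
    proof -
      have "S.comm (a, \<one>\<^bsub>H\<^esub>) (b, \<one>\<^bsub>H\<^esub>) = (A.comm a b, \<one>\<^bsub>H\<^esub>)"
        by (rule S.comm_eqI) (use ab A.mult_swap_comm[of a b] in \<open>auto simp: act_one\<close>)
      then show ?thesis
        using comm_D[of "(a, \<one>\<^bsub>H\<^esub>)" "(b, \<one>\<^bsub>H\<^esub>)"] ab by (simp add: N_def)
    qed
    moreover have "\<phi> h a \<otimes>\<^bsub>A\<^esub> inv\<^bsub>A\<^esub> a \<in> N" if ha: "h \<in> carrier H" "a \<in> carrier A" for h a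
    proof -
      have "S.comm (\<one>\<^bsub>A\<^esub>, h) (a, \<one>\<^bsub>H\<^esub>) = (\<phi> h a \<otimes>\<^bsub>A\<^esub> inv\<^bsub>A\<^esub> a, \<one>\<^bsub>H\<^esub>)"
        by (rule S.comm_eqI) (use ha in \<open>auto simp: act_one act_unit A.m_assoc\<close>)
      then show ?thesis
        using comm_D[of "(\<one>\<^bsub>A\<^esub>, h)" "(a, \<one>\<^bsub>H\<^esub>)"] ha by (simp add: N_def)
    qed
    ultimately show ?thesis unfolding X by blast
  qed
  then have gen: "generate A X \<subseteq> N" by (rule A.generate_subgroup_incl[OF _ N])
  have der: "(\<one>\<^bsub>A\<^esub>, h) \<in> ?D" if "h \<in> derived H (carrier H)" for h
  proof -
    have "(\<lambda>h. (\<one>\<^bsub>A\<^esub>, h)) ` derived H (carrier H) \<subseteq> ?D"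
      unfolding group_hom.derived_img[OF right order_refl, symmetric]
      by (rule S.mono_derived) auto
    then show ?thesis using that by blast
  qed
  show ?thesis
  proof clarify
    fix a h assume a: "a \<in> generate A X" and h: "h \<in> derived H (carrier H)"
    have ha: "a \<in> carrier A" "h \<in> carrier H" "(a, \<one>\<^bsub>H\<^esub>) \<in> ?D"
      using a gen h H.derived_in_carrier by (auto simp: N_def)
    then have "(a, \<one>\<^bsub>H\<^esub>) \<otimes>\<^bsub>S\<^esub> (\<one>\<^bsub>A\<^esub>, h) = (a, h)" by (simp add: act_one)
    then show "(a, h) \<in> ?D"
      using subgroup.m_closed[OF D ha(3) der[OF h]] by simp
  qed
qed

end

section \<open>The derived ideal of a skew brace\<close>

lemma (in group) quotient_comm_group:
  assumes N: "N \<lhd> G" and comm: "\<And>x y. \<lbrakk>x \<in> carrier G; y \<in> carrier G\<rbrakk> \<Longrightarrow> comm x y \<in> N"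
  shows "comm_group (G Mod N)"
proof (rule group.group_comm_groupI)
  interpret N: normal N G by fact
  show "group (G Mod N)" by (rule N.factorgroup_is_group)
  fix X Y assume "X \<in> carrier (G Mod N)" "Y \<in> carrier (G Mod N)"
  then obtain x y where xy: "x \<in> carrier G" "X = N #> x" "y \<in> carrier G" "Y = N #> y"
    by (auto simp: carrier_FactGroup)
  then have "N #> (x \<otimes> y) = N #> (y \<otimes> x)"
    using rcos_eq_iff[OF N.subgroup_axioms, of "x \<otimes> y" "y \<otimes> x"] comm[of x y]
    by (simp add: comm_def inv_mult_group m_assoc)
  then show "X \<otimes>\<^bsub>G Mod N\<^esub> Y = Y \<otimes>\<^bsub>G Mod N\<^esub> X"
    using xy by (simp add: N.rcos_sum)
qed

lemma (in group) kernel_quotient_map: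
  assumes "N \<lhd> G"
  shows "kernel G (G Mod N) ((#>) N) = N"
  using normal_imp_subgroup[OF assms] coset_join1[of N] coset_join2[of _ N] subgroup.subset[of N G]
  by (auto simp: kernel_def)

context skew_brace
begin

text \<open>This is the subgroup called \<open>N\<close> at the beginning.  The elements that generate it
  additively are commutators of the semidirect product.\<close>

definition commutator_star_subgroup :: "'a set" where
  "commutator_star_subgroup = generate (add_monoid B)
     ({plus.comm x y |x y. x \<in> carrier B \<and> y \<in> carrier B} \<union>
      {brace_star B x y |x y. x \<in> carrier B \<and> y \<in> carrier B})"

lemma commutator_star_subgroup: "subgroup commutator_star_subgroup (add_monoid B)"
  unfolding commutator_star_subgroup_def
  by (rule group.generate_is_subgroup[OF add_group])
    (auto simp: star_lambda lambda_closed minus_closed)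

lemma comm_in: "\<lbrakk>x \<in> carrier B; y \<in> carrier B\<rbrakk> \<Longrightarrow> plus.comm x y \<in> commutator_star_subgroup"
  and star_in: "\<lbrakk>x \<in> carrier B; y \<in> carrier B\<rbrakk> \<Longrightarrow> brace_star B x y \<in> commutator_star_subgroup"
  unfolding commutator_star_subgroup_def by (blast intro: generate.incl)+

lemma commutator_star_subgroup_normal: "commutator_star_subgroup \<lhd> add_monoid B"
  by (rule group.normal_if_comm_mem[OF add_group commutator_star_subgroup])
    (use comm_in subgroup.subset[OF commutator_star_subgroup] in auto)

lemma plus_quotient_comm_group: "comm_group (add_monoid B Mod commutator_star_subgroup)"
  by (rule group.quotient_comm_group[OF add_group commutator_star_subgroup_normal])
    (simp add: comm_in)

text \<open>Because \<open>x \<cdot> y = x + x * y + y\<close>, and \<open>x * y\<close> vanishes in the quotient.\<close>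

lemma mult_eq_add_mod:
  assumes x: "x \<in> carrier B" and y: "y \<in> carrier B"
  shows "commutator_star_subgroup +> (x \<otimes> y) = commutator_star_subgroup +> (x \<oplus> y)"
proof -
  let ?s = "brace_star B x y"
  have s: "?s \<in> commutator_star_subgroup" "?s \<in> carrier B"
    using x y star_in by (auto simp: star_lambda lambda_closed minus_closed)
  have "x \<otimes> y = x \<oplus> ?s \<oplus> y"
    using x y by (simp add: mult_eq star_lambda a_minus_def plus.m_assoc lambda_closed)
  then have "(x \<otimes> y) \<oplus> \<ominus> (x \<oplus> y) = x \<oplus> ?s \<oplus> \<ominus> x"
    using x y s by (simp add: plus.inv_mult_group plus.m_assoc) (simp flip: plus.m_assoc)
  also have "\<dots> \<in> commutator_star_subgroup"
    using normal.inv_op_closed2[OF commutator_star_subgroup_normal, of x ?s] x s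
    by (simp flip: a_inv_def)
  finally show ?thesis
    using group.rcos_eq_iff[OF add_group commutator_star_subgroup, of "x \<otimes> y" "x \<oplus> y"] x y
    by (simp add: a_r_coset_def flip: a_inv_def)
qed

lemma quotient_hom_plus: "group_hom (add_monoid B) (add_monoid B Mod commutator_star_subgroup) ((+>) commutator_star_subgroup)"
  using group_hom_quotient[OF commutator_star_subgroup_normal] by (simp add: a_r_coset_def)

text \<open>The map \<open>x \<mapsto> N + x\<close> from \<open>B\<close> to the abelian group \<open>(B, +) / N\<close> is a homomorphism for both group
  structures of \<open>B\<close>, with the same kernel \<open>N\<close>.  This makes \<open>N\<close> a multiplicative subgroup and puts the
  commutators of both structures into \<open>N\<close>.\<close>

lemma quotient_hom_times: "group_hom B (add_monoid B Mod commutator_star_subgroup) ((+>) commutator_star_subgroup)"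
  using group_hom.homh[OF quotient_hom_plus] mult_group
    normal.factorgroup_is_group[OF commutator_star_subgroup_normal]
  by (auto simp: group_hom_def group_hom_axioms_def hom_def mult_eq_add_mod)

lemma kernel_quotient:
  "kernel B (add_monoid B Mod commutator_star_subgroup) ((+>) commutator_star_subgroup) = commutator_star_subgroup"
  "kernel (add_monoid B) (add_monoid B Mod commutator_star_subgroup) ((+>) commutator_star_subgroup) = commutator_star_subgroup"
  using group.kernel_quotient_map[OF add_group commutator_star_subgroup_normal]
  by (simp_all add: kernel_def a_r_coset_def)

lemma commutator_star_subgroup_ideal: "brace_ideal commutator_star_subgroup B"
  unfolding brace_ideal_def subbrace_def
proof (intro conjI)
  show "subgroup commutator_star_subgroup (add_monoid B)" by (rule commutator_star_subgroup)
  show "subgroup commutator_star_subgroup B"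
    using group_hom.subgroup_kernel[OF quotient_hom_times] by (simp add: kernel_quotient)
  show "commutator_star_subgroup \<lhd> add_monoid B" by (rule commutator_star_subgroup_normal)
  have sub: "commutator_star_subgroup \<subseteq> carrier B"
    using subgroup.subset[OF commutator_star_subgroup] by simp
  show "brace_star_set B (carrier B) commutator_star_subgroup \<subseteq> commutator_star_subgroup"
    "brace_star_set B commutator_star_subgroup (carrier B) \<subseteq> commutator_star_subgroup"
    using sub by (auto intro!: star_set_subset[OF commutator_star_subgroup] star_in)
qed

lemma commutators_in_kernel:
  assumes hom: "group_hom G A h" and A: "comm_group A"
  shows "commutator_subgroup G (carrier G) (carrier G) \<subseteq> kernel G A h"
proof -
  interpret group_hom G A h by fact
  show ?thesis
    unfolding commutator_subgroup_def
    by (rule G.generate_subgroup_incl[OF _ subgroup_kernel])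
      (auto simp: kernel_def comm_group.commutator_trivial[OF A])
qed

theorem derived_ideal_subset:
  "brace_commutator B (carrier B) (carrier B) \<subseteq> commutator_star_subgroup"
proof -
  let ?N = commutator_star_subgroup
  let ?A = "add_monoid B Mod ?N"
  have "commutator_subgroup (add_monoid B) (carrier B) (carrier B) \<subseteq> ?N"
    using commutators_in_kernel[OF quotient_hom_plus plus_quotient_comm_group]
    by (simp add: kernel_quotient)
  moreover have "commutator_subgroup B (carrier B) (carrier B) \<subseteq> ?N"
    using commutators_in_kernel[OF quotient_hom_times plus_quotient_comm_group]
    by (simp add: kernel_quotient)
  moreover have "(x \<otimes> y) \<ominus> (x \<oplus> y) \<in> ?N" if xy: "x \<in> carrier B" "y \<in> carrier B" for x y
    using mult_eq_add_mod[OF xy] xy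
      group.rcos_eq_iff[OF add_group commutator_star_subgroup, of "x \<otimes> y" "x \<oplus> y"]
    by (simp add: a_r_coset_def a_minus_def flip: a_inv_def)
  ultimately show ?thesis
    unfolding brace_commutator_def brace_genideal_def
    using commutator_star_subgroup_ideal by (intro Inter_lower) auto
qed

definition lambda_coset :: "'a set \<Rightarrow> 'a \<Rightarrow> 'a" where
  "lambda_coset C = brace_lambda B (SOME a. a \<in> C)"

text \<open>The value does not depend on the representative, since \<open>\<lambda>\<close> is trivial on its kernel.\<close>

lemma lambda_coset:
  assumes a: "a \<in> carrier B" and b: "b \<in> carrier B"
  shows "lambda_coset (ker_lambda B #> a) b = brace_lambda B a b"
proof -
  have K: "subgroup (ker_lambda B) B" using ker_lambda_normal by (rule normal_imp_subgroup)
  have "(SOME c. c \<in> ker_lambda B #> a) \<in> ker_lambda B #> a"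
    using times.rcos_self[OF a K] by (rule someI)
  then obtain k where k: "k \<in> ker_lambda B" "(SOME c. c \<in> ker_lambda B #> a) = k \<otimes> a"
    by (auto simp: r_coset_def)
  then show ?thesis
    using a b by (simp add: lambda_coset_def lambda_mult kerD(1,2) lambda_closed)
qed

lemma semidirect_lambda: "semidirect (add_monoid B) (B Mod ker_lambda B) lambda_coset"
proof -
  interpret K: normal "ker_lambda B" B by (rule ker_lambda_normal)
  have car: "\<exists>a\<in>carrier B. C = ker_lambda B #> a" if "C \<in> carrier (B Mod ker_lambda B)" for C
    using that by (auto simp: carrier_FactGroup)
  show ?thesis
  proof (intro semidirect.intro semidirect_axioms.intro add_group K.factorgroup_is_group)
    fix C assume "C \<in> carrier (B Mod ker_lambda B)"
    then obtain a where "a \<in> carrier B" "C = ker_lambda B #> a" using car by blast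
    then show "lambda_coset C \<in> hom (add_monoid B) (add_monoid B)"
      by (auto simp: hom_def lambda_coset lambda_add lambda_closed)
  next
    fix b assume b: "b \<in> carrier (add_monoid B)"
    have "ker_lambda B = ker_lambda B #> \<one>" using K.subset by simp
    then show "lambda_coset \<one>\<^bsub>B Mod ker_lambda B\<^esub> b = b"
      using b lambda_coset[of \<one> b] by (simp add: lambda_one)
  next
    fix C D b assume "C \<in> carrier (B Mod ker_lambda B)" "D \<in> carrier (B Mod ker_lambda B)"
      and b: "b \<in> carrier (add_monoid B)"
    then obtain c d where "c \<in> carrier B" "C = ker_lambda B #> c" "d \<in> carrier B" "D = ker_lambda B #> d"
      using car by metis
    then show "lambda_coset (C \<otimes>\<^bsub>B Mod ker_lambda B\<^esub> D) b = lambda_coset C (lambda_coset D b)"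
      using b by (simp add: K.rcos_sum lambda_coset lambda_mult lambda_closed)
  qed
qed

lemma commutator_star_subgroup_generate:
  "commutator_star_subgroup = generate (add_monoid B)
     ({plus.comm a b |a b. a \<in> carrier B \<and> b \<in> carrier B} \<union>
      {lambda_coset C a \<ominus> a |C a. C \<in> carrier (B Mod ker_lambda B) \<and> a \<in> carrier B})"
proof -
  have "{brace_star B x y |x y. x \<in> carrier B \<and> y \<in> carrier B}
      = {lambda_coset C a \<ominus> a |C a. C \<in> carrier (B Mod ker_lambda B) \<and> a \<in> carrier B}"
    (is "?L = ?R")
  proof (rule subset_antisym; rule subsetI)
    fix z assume "z \<in> ?L"
    then obtain x y where xy: "x \<in> carrier B" "y \<in> carrier B" "z = brace_star B x y" by blast
    then have "z = lambda_coset (ker_lambda B #> x) y \<ominus> y"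
      by (simp add: star_lambda lambda_coset)
    moreover have "ker_lambda B #> x \<in> carrier (B Mod ker_lambda B)"
      using xy by (simp add: carrier_FactGroup)
    ultimately show "z \<in> ?R" using xy by blast
  next
    fix z assume "z \<in> ?R"
    then obtain C a where *: "C \<in> carrier (B Mod ker_lambda B)" "a \<in> carrier B"
      "z = lambda_coset C a \<ominus> a" by blast
    then obtain x where "x \<in> carrier B" "C = ker_lambda B #> x"
      by (auto simp: carrier_FactGroup)
    then have "x \<in> carrier B" "z = brace_star B x a"
      using * by (simp_all add: star_lambda lambda_coset)
    then show "z \<in> ?L" using * by blast
  qed
  then show ?thesis by (simp add: commutator_star_subgroup_def)
qed

lemma rcosets_plus_centre:
  "rcosets\<^bsub>add_monoid B\<^esub> (brace_centre B) = carrier (B Quot brace_centre B)"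
  by (simp add: FactRing_def A_RCOSETS_def)

text \<open>By Lagrange \<open>t = k * |Q|\<close>, so the index \<open>t * |Q|\<close> of \<open>Z \<times> 1\<close> in the semidirect product is \<open>t\<^sup>2 div k\<close>.\<close>

theorem derived_ideal_bound:
  assumes fin: "finite (carrier (B Quot brace_centre B))"
  defines "t \<equiv> order (B Quot brace_centre B)"
    and "k \<equiv> card (rcosets\<^bsub>B\<lparr>carrier := ker_lambda B\<rparr>\<^esub> (ker_lambda B \<inter> brace_centre B))"
    and "Q' \<equiv> derived (B Mod ker_lambda B) (carrier (B Mod ker_lambda B))"
  shows "finite (brace_commutator B (carrier B) (carrier B))"
    and "real (card (brace_commutator B (carrier B) (carrier B))) \<le> omega (t\<^sup>2 div k) / real (card Q')"
proof -
  let ?Z = "brace_centre B"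
  let ?K = "ker_lambda B"
  let ?Q = "B Mod ker_lambda B"
  let ?N = commutator_star_subgroup
  have K: "subgroup ?K B" using ker_lambda_normal by (rule normal_imp_subgroup)
  have ZK: "?Z \<subseteq> ?K" using centreD(1) by blast
  have Zp: "subgroup ?Z (add_monoid B)" using centre_ideal by (simp add: brace_ideal_def subbrace_def)
  interpret semidirect "add_monoid B" ?Q lambda_coset by (rule semidirect_lambda)
  let ?Z1 = "?Z \<times> {\<one>\<^bsub>?Q\<^esub>}"
  let ?S = "semidirect_product (add_monoid B) ?Q lambda_coset"
  have finZ: "finite (rcosets ?Z)" using fin by (simp add: centre_cosets)
  have finQ: "finite (carrier ?Q)"
    using times.finite_rcosets_tower(1)[OF K centre_subgroup ZK finZ] by (simp add: FactGroup_def)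
  have t: "t = k * card (carrier ?Q)"
    using times.card_rcosets_tower[OF K centre_subgroup ZK] ZK
    by (simp add: t_def k_def order_def centre_cosets FactGroup_def Int_absorb1)
  have t0: "0 < t" using fin finZ times.rcosets_nonempty[of ?Z] by (simp add: t_def order_def card_gt_0_iff centre_cosets)
  have index: "card (rcosets\<^bsub>?S\<^esub> ?Z1) = t * card (carrier ?Q)"
    using card_rcosets_times_one[OF Zp] by (simp add: rcosets_plus_centre t_def order_def)
  also have "\<dots> = t\<^sup>2 div k" using t t0 by (simp add: power2_eq_square) 
  finally have index': "card (rcosets\<^bsub>?S\<^esub> ?Z1) = t\<^sup>2 div k" .
  have finI: "finite (rcosets\<^bsub>?S\<^esub> ?Z1)"
    using index t0 t by (metis card.infinite mult_eq_0_iff less_irrefl)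
  have central: "z \<otimes>\<^bsub>?S\<^esub> g = g \<otimes>\<^bsub>?S\<^esub> z" if zg: "z \<in> ?Z1" "g \<in> carrier ?S" for z g
  proof -
    obtain c b a where *: "z = (c, ?K)" "c \<in> ?Z" "g = (b, ?K #> a)" "a \<in> carrier B" "b \<in> carrier B"
      using zg by (auto simp: carrier_FactGroup)
    have Ca: "?K #> a \<in> carrier ?Q" using * by (auto simp: carrier_FactGroup)
    show ?thesis
      using * H.l_one[OF Ca] H.r_one[OF Ca] act_one[of b]
      by (simp add: lambda_coset centreD)
  qed
  note wiegold = S.wiegold_bound[OF subgroup_times_one[OF Zp] central finI]
  have sub: "?N \<times> Q' \<subseteq> derived ?S (carrier ?S)"
    unfolding Q'_def
    by (rule generate_times_derived_subset[of "{plus.comm a b |a b. a \<in> carrier B \<and> b \<in> carrier B} \<union>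
      {lambda_coset C a \<ominus> a |C a. C \<in> carrier ?Q \<and> a \<in> carrier B}", folded commutator_star_subgroup_generate])
      (simp add: a_minus_def flip: a_inv_def)
  have finQ': "finite Q'" "Q' \<noteq> {}"
    using finite_subset[OF H.derived_in_carrier[OF order_refl] finQ]
      subgroup.one_closed[OF H.derived_is_subgroup[OF order_refl]] by (auto simp: Q'_def)
  have "finite (?N \<times> Q')" using sub wiegold(1) by (rule finite_subset)
  then have finN: "finite ?N" using finQ'(2) by (rule finite_cartesian_productD1)
  show fin: "finite (brace_commutator B (carrier B) (carrier B))"
    using derived_ideal_subset finN by (rule finite_subset)
  have "card (brace_commutator B (carrier B) (carrier B)) * card Q' \<le> card ?N * card Q'"
    using card_mono[OF finN derived_ideal_subset] by (rule mult_le_mono1)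
  also have "\<dots> \<le> card (derived ?S (carrier ?S))"
    using card_mono[OF wiegold(1) sub] by (simp add: card_cartesian_product)
  finally have "real (card (brace_commutator B (carrier B) (carrier B)) * card Q')
      \<le> real (card (derived ?S (carrier ?S)))"
    by (rule of_nat_mono)
  also have "\<dots> \<le> omega (t\<^sup>2 div k)"
    using wiegold(2) unfolding index' .
  finally show "real (card (brace_commutator B (carrier B) (carrier B))) \<le> omega (t\<^sup>2 div k) / real (card Q')"
    using finQ' by (simp add: pos_le_divide_eq card_gt_0_iff)
qed

end

theorem theorem3:
  fixes B :: "('a, 'm) ring_scheme" and t :: nat
  assumes "skew_brace B"
    and "finite (carrier (B Quot brace_centre B))"
    and "order (B Quot brace_centre B) = t"
  shows "finite (brace_commutator B (carrier B) (carrier B)) \<and>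
    real (card (brace_commutator B (carrier B) (carrier B)))
      \<le> omega (t\<^sup>2 div card (rcosets\<^bsub>B\<lparr>carrier := ker_lambda B\<rparr>\<^esub> (ker_lambda B \<inter> brace_centre B)))
        / real (card (derived (B Mod ker_lambda B) (carrier (B Mod ker_lambda B))))"
  using skew_brace.derived_ideal_bound[OF assms(1,2)] assms(3) by simp

end
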